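(* Suppose that the quadratures produce approximations $\widetilde{\mathbf P}$ and $\widetilde{\mathbf Q}$ to $\mathbf P$ and $\mathbf Q$, respectively, that satisfy $$\|\mathbf Q-\widetilde{\mathbf Q}\|_F\le \frac{\delta}{1+\delta}\,\sigma_{\min}(\mathbf Q)\quad\text{and}\quad \|\mathbf P-\widetilde{\mathbf P}\|_F\le \frac{\delta}{1+\delta}\,\sigma_{\min}(\mathbf P)$$ for some $\delta\in(0,1)$, where $\sigma_{\min}(\cdot)$ denotes the smallest singular value. Then there exist isometries $\boldsymbol\Psi_p\in\mathbb{C}^{N_p\times n}$ and $\boldsymbol\Psi_q\in\mathbb{C}^{N_q\times n}$ such that $$\|\widetilde{\mathbf L}^*\mathbf E\widetilde{\mathbf U}-\boldsymbol\Psi_q(\mathbf L^T\mathbf E\mathbf U)\boldsymbol\Psi_p^*\|_F\le 2\,\delta\,\|\mathbf E\|_2\,\|\mathbf L\|_2\,\|\mathbf U\|_2.$$ Let $\sigma_1\ge\sigma_2\ge\cdots\ge\sigma_n$ denote the singular values of $\mathbf L^T\mathbf E\mathbf U$ (i.e., the Hankel singular values of the system), and let $\widetilde\sigma_1\ge\widetilde\sigma_2\ge\cdots\ge\widetilde\sigma_n$ denote the singular values of $\widetilde{\mathbf L}^*\mathbf E\widetilde{\mathbf U}$. Then $$\left(\sum_{k=1}^n(\sigma_k-\widetilde\sigma_k)^2\right)^{1/2}\le 2\,\delta\,\|\mathbf E\|_2\,\|\mathbf L\|_2\,\|\mathbf U\|_2.$$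
   Context: Consider the single-input single-output linear time-invariant system $\mathbf E\dot{\mathbf x}(t)=\mathbf A\mathbf x(t)+\mathbf b\,u(t)$, $y(t)=\mathbf c^T\mathbf x(t)$, with $\mathbf E,\mathbf A\in\mathbb{R}^{n\times n}$ and $\mathbf b,\mathbf c\in\mathbb{R}^n$, where $\mathbf E$ is nonsingular and the pencil $(\mathbf A,\mathbf E)$ is asymptotically stable, i.e. all eigenvalues of $\mathbf E^{-1}\mathbf A$ lie in the open left half-plane. Here $\mathrm{i}^2=-1$. Define $$\mathbf P=\frac1{2\pi}\int_{-\infty}^{\infty}(\mathrm{i}\zeta\mathbf E-\mathbf A)^{-1}\mathbf b\mathbf b^T(-\mathrm{i}\zeta\mathbf E^T-\mathbf A^T)^{-1}d\zeta,\qquad \mathbf Q=\frac1{2\pi}\int_{-\infty}^{\infty}(-\mathrm{i}\omega\mathbf E^T-\mathbf A^T)^{-1}\mathbf c\mathbf c^T(\mathrm{i}\omega\mathbf E-\mathbf A)^{-1}d\omega,$$ which are real symmetric positive semidefinite, and let $\mathbf U,\mathbf L\in\mathbb{R}^{n\times n}$ be square factors with $\mathbf P=\mathbf U\mathbf U^T$, $\mathbf Q=\mathbf L\mathbf L^T$ (e.g. Cholesky factors). The singular values of $\mathbf L^T\mathbf E\mathbf U$ are the Hankel singular values of the system. Let $\zeta_1,\dots,\zeta_{\ell_p}\in\mathbb{R}$ and $\omega_1,\dots,\omega_{\ell_q}\in\mathbb{R}$ be quadrature nodes, with quadrature weights $\rho_j^2$, $\phi_k^2$ ($\rho_j,\phi_k$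 real). Each of the two quadrature rules may in addition contain a "node at infinity" with weight $\rho_\infty^2$ (resp. $\phi_\infty^2$), where $\rho_\infty,\phi_\infty$ are real. The total number of nodes is $N_p=\ell_p$ if the node at infinity is absent from the first rule and $N_p=\ell_p+1$ if it is present; likewise $N_q=\ell_q$ or $N_q=\ell_q+1$. Define $$\widetilde{\mathbf U}=\big[\rho_1(\mathrm{i}\zeta_1\mathbf E-\mathbf A)^{-1}\mathbf b\ \ \cdots\ \ \rho_{\ell_p}(\mathrm{i}\zeta_{\ell_p}\mathbf E-\mathbf A)^{-1}\mathbf b\ \ \ \rho_\infty\mathbf E^{-1}\mathbf b\big]\in\mathbb{C}^{n\times N_p},$$ $$\widetilde{\mathbf L}^*=\begin{bmatrix}\phi_1\mathbf c^T(\mathrm{i}\omega_1\mathbf E-\mathbf A)^{-1}\\ \vdots\\ \phi_{\ell_q}\mathbf c^T(\mathrm{i}\omega_{\ell_q}\mathbf E-\mathbf A)^{-1}\\ \phi_\infty\mathbf c^T\mathbf E^{-1}\end{bmatrix}\in\mathbb{C}^{N_q\times n},$$ where the last column of $\widetilde{\mathbf U}$ (resp. last row of $\widetilde{\mathbf L}^*$) is omitted if the corresponding node at infinity is absent. The quadrature approximations are $\widetilde{\mathbf P}=\widetilde{\mathbf U}\widetilde{\mathbf U}^*$ and $\widetilde{\mathbf Q}=\widetilde{\mathbf L}\widetilde{\mathbf L}^*$, that is, $$\widetilde{\mathbf P}=\sum_{j=1}^{\ell_p}\rho_j^2(\mathrm{i}\zeta_j\mathbf E-\mathbf A)^{-1}\mathbf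 b\mathbf b^T(-\mathrm{i}\zeta_j\mathbf E^T-\mathbf A^T)^{-1}+\rho_\infty^2\mathbf E^{-1}\mathbf b\mathbf b^T\mathbf E^{-T},$$ $$\widetilde{\mathbf Q}=\sum_{k=1}^{\ell_q}\phi_k^2(-\mathrm{i}\omega_k\mathbf E^T-\mathbf A^T)^{-1}\mathbf c\mathbf c^T(\mathrm{i}\omega_k\mathbf E-\mathbf A)^{-1}+\phi_\infty^2\mathbf E^{-T}\mathbf c\mathbf c^T\mathbf E^{-1}$$ (terms with $\infty$ omitted if absent). $\|\cdot\|_F$ and $\|\cdot\|_2$ are the Frobenius and spectral norms, ${}^*$ is the conjugate transpose, and an isometry $\boldsymbol\Psi\in\mathbb{C}^{N\times n}$ is a matrix with $\boldsymbol\Psi^*\boldsymbol\Psi=\mathbf I_n$.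
   Formalization: Added assumption: N_p ≥ n or P is nonsingular, and N_q ≥ n or Q is nonsingular; otherwise (e.g. n = 2, b = c = 0, one node per rule) the bounds hold trivially but no isometry in C^{N_p×n} (or C^{N_q×n}) exists. *)

theory Defs
  imports
    "HOL-Analysis.Analysis"
    "Jordan_Normal_Form.Schur_Decomposition"
    "Jordan_Normal_Form.Gauss_Jordan_Elimination"
begin

text \<open>Matrices and vectors are those of \<^theory>\<open>Jordan_Normal_Form.Matrix\<close>, since the sizes of the
  quadrature factors depend on the number of nodes.\<close>

unbundle no vec_syntax
hide_const (open) Finite_Cartesian_Product.vec Finite_Cartesian_Product.mat
  Finite_Cartesian_Product.row Finite_Cartesian_Product.column

abbreviation cmat :: "real mat \<Rightarrow> complex mat" where
  "cmat \<equiv> map_mat complex_of_real"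

text \<open>Only meaningful for invertible square matrices.\<close>
definition minv :: "'a :: field mat \<Rightarrow> 'a mat" where
  "minv M = the (mat_inverse M)"

definition col_mat :: "real vec \<Rightarrow> complex mat" where
  "col_mat v = cmat (mat_of_cols (dim_vec v) [v])"

subsection \<open>Norms, singular values, isometries\<close>

definition l2_norm :: "complex vec \<Rightarrow> real" where
  "l2_norm v = sqrt (\<Sum>i<dim_vec v. (cmod (v $ i))\<^sup>2)"

definition frob_norm :: "complex mat \<Rightarrow> real" where
  "frob_norm M = sqrt (\<Sum>i<dim_row M. \<Sum>j<dim_col M. (cmod (M $$ (i, j)))\<^sup>2)"

definition spectral_norm :: "complex mat \<Rightarrow> real" where
  "spectral_norm M = (SUP v \<in> {v \<in> carrier_vec (dim_col M). l2_norm v = 1}. l2_norm (M *\<^sub>v v))"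

text \<open>The square roots of the eigenvalues of \<open>M\<^sup>* M\<close>, with algebraic multiplicity, in decreasing
  order. An \<open>m \<times> k\<close> matrix has \<open>min m k\<close> singular values; if \<open>m < k\<close>, the truncation
  drops \<open>k - m\<close> zeros that are forced by the rank of \<open>M\<^sup>* M\<close>.\<close>
definition singular_values :: "complex mat \<Rightarrow> real list" where
  "singular_values M = take (min (dim_row M) (dim_col M))
     (rev (sorted_list_of_multiset
        (image_mset (\<lambda>z. sqrt (Re z)) (proots (char_poly (mat_adjoint M * M))))))"

lemma length_singular_values:
  "length (singular_values M) = min (dim_row M) (dim_col M)"
proof -
  have "mat_adjoint M * M \<in> carrier_mat (dim_col M) (dim_col M)"
    by (intro carrier_matI) (simp_all add: mat_adjoint_def)
  then have "degree (char_poly (mat_adjoint M * M)) = dim_col M"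
    by (rule degree_monic_char_poly[THEN conjunct1])
  moreover have "length (sorted_list_of_multiset X) = size X" for X :: "real multiset"
    by (metis mset_sorted_list_of_multiset size_mset)
  ultimately show ?thesis
    by (simp add: singular_values_def size_proots_complex)
qed

text \<open>Numbered from 1; only meaningful for \<open>1 \<le> k \<le> min (dim_row M) (dim_col M)\<close>.\<close>
definition sing_val :: "complex mat \<Rightarrow> nat \<Rightarrow> real" where
  "sing_val M k = singular_values M ! (k - 1)"

definition sigma_min :: "complex mat \<Rightarrow> real" where
  "sigma_min M = last (singular_values M)"

definition isometry :: "nat \<Rightarrow> nat \<Rightarrow> complex mat \<Rightarrow> bool" where
  "isometry N n \<Psi> \<longleftrightarrow> \<Psi> \<in> carrier_mat N n \<and> mat_adjoint \<Psi> * \<Psi> = 1\<^sub>m n"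

subsection \<open>The system and its Gramians\<close>

definition asymptotically_stable :: "real mat \<Rightarrow> real mat \<Rightarrow> bool" where
  "asymptotically_stable E A \<longleftrightarrow> (\<forall>z. eigenvalue (cmat (minv E * A)) z \<longrightarrow> Re z < 0)"

definition resolvent :: "real mat \<Rightarrow> real mat \<Rightarrow> real \<Rightarrow> complex mat" where
  "resolvent E A z = minv ((\<i> * of_real z) \<cdot>\<^sub>m cmat E - cmat A)"

definition resolvent_star :: "real mat \<Rightarrow> real mat \<Rightarrow> real \<Rightarrow> complex mat" where
  "resolvent_star E A z =
     minv ((- \<i> * of_real z) \<cdot>\<^sub>m cmat (transpose_mat E) - cmat (transpose_mat A))"

text \<open>The matrix-valued integrals are taken entrywise.\<close>
definition gramian_P :: "nat \<Rightarrow> real mat \<Rightarrow> real mat \<Rightarrow> real vec \<Rightarrow> complex mat" where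
  "gramian_P n E A b = Matrix.mat n n (\<lambda>(i, j). 1 / (2 * of_real pi) *
     (LINT z|lborel.
       (resolvent E A z * col_mat b * transpose_mat (col_mat b) * resolvent_star E A z) $$ (i, j)))"

definition gramian_Q :: "nat \<Rightarrow> real mat \<Rightarrow> real mat \<Rightarrow> real vec \<Rightarrow> complex mat" where
  "gramian_Q n E A c = Matrix.mat n n (\<lambda>(i, j). 1 / (2 * of_real pi) *
     (LINT w|lborel.
       (resolvent_star E A w * col_mat c * transpose_mat (col_mat c) * resolvent E A w) $$ (i, j)))"

subsection \<open>Quadrature factors\<close>

text \<open>A quadrature rule has nodes \<open>z 1, \<dots>, z l\<close> with weights \<open>(r 1)\<^sup>2, \<dots>, (r l)\<^sup>2\<close>. The argument
  \<open>rinf\<close> is \<open>None\<close> if there is no node at infinity, and \<open>Some t\<close> if there is one, with weight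
  \<open>t\<^sup>2\<close> (possibly \<open>t = 0\<close>).\<close>

definition num_nodes :: "nat \<Rightarrow> real option \<Rightarrow> nat" where
  "num_nodes l rinf = (case rinf of None \<Rightarrow> l | Some _ \<Rightarrow> l + 1)"

definition U_quad ::
  "nat \<Rightarrow> real mat \<Rightarrow> real mat \<Rightarrow> real vec \<Rightarrow> nat \<Rightarrow> (nat \<Rightarrow> real) \<Rightarrow> (nat \<Rightarrow> real) \<Rightarrow> real option
     \<Rightarrow> complex mat" where
  "U_quad n E A b l z r rinf = mat_of_cols n
     (map (\<lambda>j. of_real (r j) \<cdot>\<^sub>v (resolvent E A (z j) *\<^sub>v map_vec of_real b)) [1..<l + 1]
      @ (case rinf of None \<Rightarrow> []
         | Some t \<Rightarrow> [of_real t \<cdot>\<^sub>v (cmat (minv E) *\<^sub>v map_vec of_real b)]))"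

text \<open>The conjugate transpose of the factor of the approximation to \<open>Q\<close>. The row vector
  \<open>c\<^sup>T M\<close> is written as \<open>M\<^sup>T c\<close>.\<close>
definition L_quad_star ::
  "nat \<Rightarrow> real mat \<Rightarrow> real mat \<Rightarrow> real vec \<Rightarrow> nat \<Rightarrow> (nat \<Rightarrow> real) \<Rightarrow> (nat \<Rightarrow> real) \<Rightarrow> real option
     \<Rightarrow> complex mat" where
  "L_quad_star n E A c l w f finf = mat_of_rows n
     (map (\<lambda>k. of_real (f k) \<cdot>\<^sub>v (transpose_mat (resolvent E A (w k)) *\<^sub>v map_vec of_real c))
        [1..<l + 1]
      @ (case finf of None \<Rightarrow> []
         | Some t \<Rightarrow> [of_real t \<cdot>\<^sub>v (transpose_mat (cmat (minv E)) *\<^sub>v map_vec of_real c)]))"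

lemma U_quad_carrier: "U_quad n E A b l z r rinf \<in> carrier_mat n (num_nodes l rinf)"
  by (intro carrier_matI) (simp_all add: U_quad_def num_nodes_def split: option.split)

lemma L_quad_star_carrier: "L_quad_star n E A c l w f finf \<in> carrier_mat (num_nodes l finf) n"
  by (intro carrier_matI) (simp_all add: L_quad_star_def num_nodes_def split: option.split)

definition P_quad ::
  "nat \<Rightarrow> real mat \<Rightarrow> real mat \<Rightarrow> real vec \<Rightarrow> nat \<Rightarrow> (nat \<Rightarrow> real) \<Rightarrow> (nat \<Rightarrow> real) \<Rightarrow> real option
     \<Rightarrow> complex mat" where
  "P_quad n E A b l z r rinf = U_quad n E A b l z r rinf * mat_adjoint (U_quad n E A b l z r rinf)"

definition Q_quad ::
  "nat \<Rightarrow> real mat \<Rightarrow> real mat \<Rightarrow> real vec \<Rightarrow> nat \<Rightarrow> (nat \<Rightarrow> real) \<Rightarrow> (nat \<Rightarrow> real) \<Rightarrow> real option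
     \<Rightarrow> complex mat" where
  "Q_quad n E A c l w f finf =
     mat_adjoint (L_quad_star n E A c l w f finf) * L_quad_star n E A c l w f finf"

end

theory Submission
  imports Defs
begin

text \<open>
  The bound compares two products \<open>X E W\<close> and \<open>Y E Z\<close>, where \<open>W\<close> is the quadrature factor of the
  approximation to \<open>P = U U\<^sup>*\<close>, \<open>X\<close> is the adjoint of the quadrature factor of the approximation to
  \<open>Q = L L\<^sup>*\<close>, \<open>Z = U \<Psi>\<^sub>p\<^sup>*\<close> and \<open>Y = \<Psi>\<^sub>q L\<^sup>*\<close>. Everything rests on the fact that square root factors of nearby
  positive semidefinite matrices are close up to an isometry: if \<open>W W\<^sup>*\<close> differs from \<open>U U\<^sup>*\<close> by at most
  \<open>\<epsilon>\<close> times the smallest singular value of \<open>U U\<^sup>*\<close>, then \<open>W\<close> differs from some \<open>U \<Psi>\<^sup>*\<close> by at most \<open>\<epsilon> \<parallel>U\<parallel>\<close>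
  (\<open>square_root_factor_perturbation\<close>). For invertible \<open>U\<close>, the matrix \<open>M = U\<^sup>-\<^sup>1 W\<close> satisfies
  \<open>\<parallel>M M\<^sup>* - I\<parallel> \<le> \<epsilon>\<close>, so its singular values are as close to 1, and \<open>\<Psi>\<^sup>*\<close> is the isometric factor of its polar
  decomposition (\<open>near_coisometry\<close>). For singular \<open>U\<close>, the tolerance is zero, and two matrices with the same Gram
  matrix differ by an isometry (\<open>same_gram_isometry\<close>).

  Exchanging one factor at a time, one of the two errors is multiplied by \<open>\<parallel>W\<parallel> \<le> (1 + \<epsilon>) \<parallel>U\<parallel>\<close>, so that the
  total is \<open>\<epsilon> (2 + \<epsilon>) \<parallel>E\<parallel> \<parallel>L\<parallel> \<parallel>U\<parallel>\<close> (\<open>product_perturbation\<close>). With \<open>\<epsilon> = \<delta> / (1 + \<delta>)\<close> this is below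
  \<open>2 \<delta> \<parallel>E\<parallel> \<parallel>L\<parallel> \<parallel>U\<parallel>\<close>.

  The estimate for the singular values is Mirsky's theorem (\<open>Mirsky_isometries\<close>): the singular values of \<open>\<Psi>\<^sub>q H \<Psi>\<^sub>p\<^sup>*\<close>
  are those of \<open>H\<close> and zeros, and the Frobenius distance of two matrices dominates the Euclidean distance of
  their singular values. It follows from von Neumann's trace inequality, and this from singular value
  decompositions and summation by parts. The decompositions come from the spectral theorem for Hermitian
  matrices, proved by splitting off one eigenvector at a time.
\<close>

section \<open>Adjoints, norms and operator bounds\<close>

lemma mat_adjoint_dim [simp]:
  "dim_row (mat_adjoint A) = dim_col A" "dim_col (mat_adjoint A) = dim_row A"
  by (simp_all add: mat_adjoint_def)

lemma mat_adjoint_carrier [simp]: "mat_adjoint A \<in> carrier_mat n m \<longleftrightarrow> A \<in> carrier_mat m n"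
  unfolding carrier_mat_def by auto

lemma mat_adjoint_index [simp]:
  "i < dim_col A \<Longrightarrow> j < dim_row A \<Longrightarrow> mat_adjoint A $$ (i, j) = cnj (A $$ (j, i))"
  for A :: "complex mat"
  by (simp add: mat_adjoint_def mat_of_rows_def)

lemma mult_mat_index:
  assumes "A \<in> carrier_mat n k" "B \<in> carrier_mat k m" "i < n" "j < m"
  shows "(A * B) $$ (i, j) = (\<Sum>l<k. A $$ (i, l) * B $$ (l, j))"
  using assms by (simp add: scalar_prod_def atLeast0LessThan)

text \<open>Unlike \<open>assoc_mult_mat\<close>, whose carrier premises have to be guessed, this form lets the
  simplifier normalize products from the dimensions alone.\<close>
lemma assoc_mult_mat_dim:
  "dim_col A = dim_row B \<Longrightarrow> dim_col B = dim_row C \<Longrightarrow> A * B * C = A * (B * C)"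
  by (rule assoc_mult_mat) auto

lemma mult_mat_vec_index:
  assumes "A \<in> carrier_mat n k" "v \<in> carrier_vec k" "i < n"
  shows "(A *\<^sub>v v) $ i = (\<Sum>l<k. A $$ (i, l) * v $ l)"
  using assms by (simp add: scalar_prod_def atLeast0LessThan)

lemma cscalar_prod_sum:
  fixes v w :: "complex vec"
  assumes "w \<in> carrier_vec n"
  shows "v \<bullet>c w = (\<Sum>i<n. v $ i * cnj (w $ i))"
  using assms by (simp add: scalar_prod_def atLeast0LessThan)

lemma mat_adjoint_adjoint [simp]: "mat_adjoint (mat_adjoint A) = A"
  for A :: "complex mat"
  by (rule eq_matI) auto

lemma mat_adjoint_mult:
  fixes A B :: "complex mat"
  assumes "A \<in> carrier_mat n k" "B \<in> carrier_mat k m"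
  shows "mat_adjoint (A * B) = mat_adjoint B * mat_adjoint A"
proof (rule eq_matI)
  fix i j
  assume "i < dim_row (mat_adjoint B * mat_adjoint A)" "j < dim_col (mat_adjoint B * mat_adjoint A)"
  then have ij: "i < m" "j < n" using assms by auto
  have "mat_adjoint (A * B) $$ (i, j) = cnj (\<Sum>l<k. A $$ (j, l) * B $$ (l, i))"
    using assms ij by (subst mult_mat_index[symmetric]) auto
  also have "\<dots> = (\<Sum>l<k. mat_adjoint B $$ (i, l) * mat_adjoint A $$ (l, j))"
    using assms ij by (auto simp: mult.commute intro!: sum.cong)
  also have "\<dots> = (mat_adjoint B * mat_adjoint A) $$ (i, j)"
    using assms ij by (subst mult_mat_index) auto
  finally show "mat_adjoint (A * B) $$ (i, j) = (mat_adjoint B * mat_adjoint A) $$ (i, j)" .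
qed (use assms in auto)

lemma mat_adjoint_one [simp]: "mat_adjoint (1\<^sub>m n :: complex mat) = 1\<^sub>m n"
  by (rule eq_matI) auto

lemma mat_adjoint_minus:
  fixes A B :: "complex mat"
  assumes "A \<in> carrier_mat n m" "B \<in> carrier_mat n m"
  shows "mat_adjoint (A - B) = mat_adjoint A - mat_adjoint B"
  using assms by (intro eq_matI) auto

lemma mat_adjoint_cmat: "mat_adjoint (cmat A) = cmat (transpose_mat A)"
  by (rule eq_matI) auto

lemma cmat_mult:
  assumes "A \<in> carrier_mat n k" "B \<in> carrier_mat k m"
  shows "cmat (A * B) = cmat A * cmat B"
  by (rule of_real_hom.mat_hom_mult[OF assms])

lemma cscalar_prod_adjoint:
  fixes A :: "complex mat"
  assumes "A \<in> carrier_mat n m" "x \<in> carrier_vec m" "y \<in> carrier_vec n"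
  shows "(A *\<^sub>v x) \<bullet>c y = x \<bullet>c (mat_adjoint A *\<^sub>v y)"
proof -
  have "(A *\<^sub>v x) \<bullet>c y = (\<Sum>i<n. \<Sum>l<m. A $$ (i, l) * x $ l * cnj (y $ i))"
    using assms by (simp add: cscalar_prod_sum[of y n] mult_mat_vec_index[of A n m] sum_distrib_right
        del: index_mult_mat_vec)
  also have "\<dots> = (\<Sum>l<m. \<Sum>i<n. A $$ (i, l) * x $ l * cnj (y $ i))"
    by (rule sum.swap)
  also have "\<dots> = x \<bullet>c (mat_adjoint A *\<^sub>v y)"
    using assms
    by (subst cscalar_prod_sum[of _ m])
      (auto simp: mult_mat_vec_index[of _ m n] sum_distrib_left mult_ac
        simp del: index_mult_mat_vec intro!: sum.cong)
  finally show ?thesis .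
qed

lemma l2_norm_L2_set: "l2_norm v = L2_set (\<lambda>i. cmod (v $ i)) {..<dim_vec v}"
  by (simp add: l2_norm_def L2_set_def)

lemma frob_norm_L2_set:
  "frob_norm M = L2_set (\<lambda>(i, j). cmod (M $$ (i, j))) ({..<dim_row M} \<times> {..<dim_col M})"
  by (simp add: frob_norm_def L2_set_def sum.cartesian_product case_prod_beta)

lemma l2_norm_nonneg [simp]: "0 \<le> l2_norm v"
  by (simp add: l2_norm_L2_set L2_set_nonneg)

lemma frob_norm_nonneg [simp]: "0 \<le> frob_norm M"
  by (simp add: frob_norm_L2_set L2_set_nonneg)

lemma l2_norm_power2: "(l2_norm v)\<^sup>2 = (\<Sum>i<dim_vec v. (cmod (v $ i))\<^sup>2)"
  unfolding l2_norm_def by (rule real_sqrt_pow2) (simp add: sum_nonneg)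

lemma frob_norm_power2:
  "(frob_norm M)\<^sup>2 = (\<Sum>i<dim_row M. \<Sum>j<dim_col M. (cmod (M $$ (i, j)))\<^sup>2)"
  unfolding frob_norm_def by (rule real_sqrt_pow2) (simp add: sum_nonneg)

lemma frob_norm_power2_cols: "(frob_norm M)\<^sup>2 = (\<Sum>j<dim_col M. (l2_norm (col M j))\<^sup>2)"
  unfolding frob_norm_power2 l2_norm_power2 by (subst sum.swap) simp

lemma cscalar_prod_self: "v \<bullet>c v = complex_of_real ((l2_norm v)\<^sup>2)"
  unfolding cscalar_prod_sum[OF carrier_vec_dim_vec] l2_norm_power2 of_real_sum complex_norm_square ..

lemma l2_norm_0 [simp]: "l2_norm (0\<^sub>v n) = 0"
  by (simp add: l2_norm_def)

lemma l2_norm_unit_vec: "k < n \<Longrightarrow> l2_norm (unit_vec n k) = 1"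
proof -
  assume k: "k < n"
  have "(\<Sum>i<n. (cmod (unit_vec n k $ i))\<^sup>2) = (\<Sum>i<n. if k = i then 1 else 0)"
    using k by (intro sum.cong) auto
  then show ?thesis using k by (simp add: l2_norm_def)
qed

lemma l2_norm_eq_0: "v \<in> carrier_vec n \<Longrightarrow> l2_norm v = 0 \<longleftrightarrow> v = 0\<^sub>v n"
  by (auto simp: l2_norm_L2_set L2_set_eq_0_iff)

lemma l2_norm_smult: "l2_norm (a \<cdot>\<^sub>v v) = cmod a * l2_norm v"
  by (simp add: l2_norm_def norm_mult power_mult_distrib sum_distrib_left[symmetric] real_sqrt_mult)

lemma cscalar_prod_Cauchy_Schwarz:
  assumes "v \<in> carrier_vec n" "w \<in> carrier_vec n"
  shows "cmod (v \<bullet>c w) \<le> l2_norm v * l2_norm w"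
proof -
  have "cmod (v \<bullet>c w) \<le> (\<Sum>i<n. cmod (v $ i) * cmod (w $ i))"
    unfolding cscalar_prod_sum[OF assms(2)]
    by (rule order_trans[OF norm_sum]) (simp add: norm_mult)
  also have "\<dots> \<le> l2_norm v * l2_norm w"
    using L2_set_mult_ineq[of "\<lambda>i. cmod (v $ i)" "\<lambda>i. cmod (w $ i)" "{..<n}"] assms
    by (simp add: l2_norm_L2_set)
  finally show ?thesis .
qed

lemma l2_norm_triangle:
  assumes "v \<in> carrier_vec n" "w \<in> carrier_vec n"
  shows "l2_norm (v + w) \<le> l2_norm v + l2_norm w"
proof -
  have "l2_norm (v + w) \<le> L2_set (\<lambda>i. cmod (v $ i) + cmod (w $ i)) {..<n}"
    using assms unfolding l2_norm_L2_set by (auto intro!: L2_set_mono norm_triangle_ineq)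
  also have "\<dots> \<le> l2_norm v + l2_norm w"
    using assms by (intro order_trans[OF L2_set_triangle_ineq]) (simp add: l2_norm_L2_set)
  finally show ?thesis .
qed

lemma frob_norm_triangle:
  assumes "A \<in> carrier_mat n m" "B \<in> carrier_mat n m"
  shows "frob_norm (A + B) \<le> frob_norm A + frob_norm B"
proof -
  have "frob_norm (A + B) \<le>
      L2_set (\<lambda>p. (case p of (i, j) \<Rightarrow> cmod (A $$ (i, j))) + (case p of (i, j) \<Rightarrow> cmod (B $$ (i, j))))
        ({..<n} \<times> {..<m})"
    using assms unfolding frob_norm_L2_set by (auto intro!: L2_set_mono norm_triangle_ineq)
  also have "\<dots> \<le> frob_norm A + frob_norm B"
    using assms by (intro order_trans[OF L2_set_triangle_ineq]) (simp add: frob_norm_L2_set case_prod_beta')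
  finally show ?thesis .
qed

lemma frob_norm_adjoint [simp]: "frob_norm (mat_adjoint M) = frob_norm M"
proof -
  have "(\<Sum>i<dim_col M. \<Sum>j<dim_row M. (cmod (M $$ (j, i)))\<^sup>2) =
      (\<Sum>j<dim_row M. \<Sum>i<dim_col M. (cmod (M $$ (j, i)))\<^sup>2)"
    by (rule sum.swap)
  then show ?thesis by (simp add: frob_norm_def)
qed

lemma frob_norm_minus_commute:
  assumes "A \<in> carrier_mat n m" "B \<in> carrier_mat n m"
  shows "frob_norm (A - B) = frob_norm (B - A)"
  using assms by (simp add: frob_norm_def norm_minus_commute)

lemma frob_norm_eq_0D:
  assumes "frob_norm M = 0" "M \<in> carrier_mat n m"
  shows "M = 0\<^sub>m n m"
proof (rule eq_matI)
  fix i j assume "i < dim_row (0\<^sub>m n m)" "j < dim_col (0\<^sub>m n m)"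
  moreover have "\<forall>p \<in> {..<n} \<times> {..<m}. (case p of (i, j) \<Rightarrow> cmod (M $$ (i, j))) = 0"
    using assms unfolding frob_norm_L2_set by (subst (asm) L2_set_eq_0_iff) auto
  ultimately show "M $$ (i, j) = 0\<^sub>m n m $$ (i, j)" by auto
qed (use assms in auto)

text \<open>\<open>r\<close> is an upper bound, not necessarily the least one, of the operator norm of \<open>K\<close>. All that
  the estimates need of the spectral norm is that it is such a bound.\<close>
definition op_bound :: "complex mat \<Rightarrow> real \<Rightarrow> bool" where
  "op_bound K r \<longleftrightarrow> 0 \<le> r \<and> (\<forall>v \<in> carrier_vec (dim_col K). l2_norm (K *\<^sub>v v) \<le> r * l2_norm v)"

lemma op_bound_nonneg: "op_bound K r \<Longrightarrow> 0 \<le> r"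
  by (simp add: op_bound_def)

lemma op_boundD:
  "op_bound K r \<Longrightarrow> K \<in> carrier_mat n m \<Longrightarrow> v \<in> carrier_vec m \<Longrightarrow> l2_norm (K *\<^sub>v v) \<le> r * l2_norm v"
  by (auto simp: op_bound_def)

text \<open>\<open>\<parallel>K\<^sup>* y\<parallel>\<^sup>2 = \<langle>y, K K\<^sup>* y\<rangle> \<le> \<parallel>y\<parallel> \<cdot> r \<parallel>K\<^sup>* y\<parallel>\<close>.\<close>
lemma op_bound_adjoint:
  assumes "op_bound K r"
  shows "op_bound (mat_adjoint K) r"
  unfolding op_bound_def
proof (intro conjI ballI)
  fix y :: "complex vec" assume "y \<in> carrier_vec (dim_col (mat_adjoint K))"
  then have y: "y \<in> carrier_vec (dim_row K)" by simp
  define x where "x = mat_adjoint K *\<^sub>v (y :: complex vec)"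
  have x: "x \<in> carrier_vec (dim_col K)" by (rule carrier_vecI) (simp add: x_def)
  have "complex_of_real ((l2_norm x)\<^sup>2) = (K *\<^sub>v x) \<bullet>c y"
    unfolding cscalar_prod_self[symmetric]
    by (subst cscalar_prod_adjoint[of _ "dim_row K" "dim_col K"]) (use x y x_def in auto)
  then have "(l2_norm x)\<^sup>2 = cmod ((K *\<^sub>v x) \<bullet>c y)"
    by (metis norm_of_real abs_power2)
  also have "\<dots> \<le> l2_norm (K *\<^sub>v x) * l2_norm y"
    by (rule cscalar_prod_Cauchy_Schwarz[of _ "dim_row K"]) (use y in \<open>auto intro: carrier_vecI\<close>)
  also have "\<dots> \<le> r * l2_norm x * l2_norm y"
    using assms x by (intro mult_right_mono) (auto simp: op_bound_def)
  finally have "l2_norm x * l2_norm x \<le> (r * l2_norm y) * l2_norm x"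
    by (simp add: power2_eq_square mult_ac)
  then show "l2_norm (mat_adjoint K *\<^sub>v y) \<le> r * l2_norm y"
    using op_bound_nonneg[OF assms] unfolding x_def[symmetric]
    by (cases "l2_norm x = 0") (auto simp: less_le)
qed (use assms in \<open>auto simp: op_bound_def\<close>)

text \<open>Applied column by column, the operator bound gives the mixed submultiplicativity of the
  Frobenius norm.\<close>
lemma frob_norm_mult_left:
  assumes K: "op_bound K r" "K \<in> carrier_mat n k" and B: "B \<in> carrier_mat k m"
  shows "frob_norm (K * B) \<le> r * frob_norm B"
proof (rule power2_le_imp_le)
  have "(frob_norm (K * B))\<^sup>2 = (\<Sum>j<m. (l2_norm (K *\<^sub>v col B j))\<^sup>2)"
    using K B by (simp add: frob_norm_power2_cols col_mult2 del: col_mult)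
  also have "\<dots> \<le> (\<Sum>j<m. (r * l2_norm (col B j))\<^sup>2)"
    using K B by (intro sum_mono power_mono op_boundD) auto
  also have "\<dots> = (r * frob_norm B)\<^sup>2"
    using B by (simp add: frob_norm_power2_cols power_mult_distrib sum_distrib_left)
  finally show "(frob_norm (K * B))\<^sup>2 \<le> (r * frob_norm B)\<^sup>2" .
qed (use op_bound_nonneg[OF K(1)] in simp)

lemma frob_norm_mult_right:
  assumes K: "op_bound K r" "K \<in> carrier_mat k m" and B: "B \<in> carrier_mat n k"
  shows "frob_norm (B * K) \<le> frob_norm B * r"
proof -
  have "frob_norm (B * K) = frob_norm (mat_adjoint K * mat_adjoint B)"
    using K B mat_adjoint_mult by (metis frob_norm_adjoint)
  also have "\<dots> \<le> r * frob_norm (mat_adjoint B)"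
    by (rule frob_norm_mult_left[OF op_bound_adjoint[OF K(1)]]) (use K B in auto)
  finally show ?thesis by (simp add: mult.commute)
qed

lemma op_bound_mult:
  assumes "op_bound A r" "A \<in> carrier_mat n k" "op_bound B s" "B \<in> carrier_mat k m"
  shows "op_bound (A * B) (r * s)"
  unfolding op_bound_def
proof (intro conjI ballI)
  fix v :: "complex vec" assume "v \<in> carrier_vec (dim_col (A * B))"
  then have v: "v \<in> carrier_vec m" using assms by auto
  have "l2_norm (A * B *\<^sub>v v) = l2_norm (A *\<^sub>v (B *\<^sub>v v))" using assms v by simp
  also have "\<dots> \<le> r * l2_norm (B *\<^sub>v v)" using assms v by (intro op_boundD) auto
  also have "\<dots> \<le> r * (s * l2_norm v)"
    using assms v by (intro mult_left_mono op_boundD op_bound_nonneg) auto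
  finally show "l2_norm (A * B *\<^sub>v v) \<le> r * s * l2_norm v" by (simp add: mult_ac)
qed (use assms in \<open>auto simp: op_bound_def\<close>)

lemma op_bound_add:
  assumes "op_bound A r" "A \<in> carrier_mat n m" "op_bound B s" "B \<in> carrier_mat n m"
  shows "op_bound (A + B) (r + s)"
  unfolding op_bound_def
proof (intro conjI ballI)
  fix v :: "complex vec" assume "v \<in> carrier_vec (dim_col (A + B))"
  then have v: "v \<in> carrier_vec m" using assms by auto
  have "l2_norm ((A + B) *\<^sub>v v) \<le> l2_norm (A *\<^sub>v v) + l2_norm (B *\<^sub>v v)"
    unfolding add_mult_distrib_mat_vec[OF assms(2,4) v]
    by (rule l2_norm_triangle[of _ n]) (use assms v in auto)
  also have "\<dots> \<le> r * l2_norm v + s * l2_norm v"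
    using assms v by (intro add_mono op_boundD) auto
  finally show "l2_norm ((A + B) *\<^sub>v v) \<le> (r + s) * l2_norm v" by (simp add: algebra_simps)
qed (use assms in \<open>auto simp: op_bound_def\<close>)

text \<open>The Cauchy--Schwarz inequality, row by row.\<close>
lemma op_bound_frob_norm: "op_bound M (frob_norm M)"
  unfolding op_bound_def
proof (intro conjI ballI)
  fix v :: "complex vec" assume v: "v \<in> carrier_vec (dim_col M)"
  have row: "row M i \<in> carrier_vec (dim_col M)" for i by (rule carrier_vecI) simp
  show "l2_norm (M *\<^sub>v v) \<le> frob_norm M * l2_norm v"
  proof (rule power2_le_imp_le)
    have "(l2_norm (M *\<^sub>v v))\<^sup>2 = (\<Sum>i<dim_row M. (cmod (v \<bullet>c conjugate (row M i)))\<^sup>2)"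
      using v by (auto simp: l2_norm_power2 comm_scalar_prod[OF row] intro!: sum.cong)
    also have "\<dots> \<le> (\<Sum>i<dim_row M. (l2_norm v * l2_norm (conjugate (row M i)))\<^sup>2)"
      using v by (intro sum_mono power_mono cscalar_prod_Cauchy_Schwarz[of _ "dim_col M"]) auto
    also have "\<dots> = (frob_norm M * l2_norm v)\<^sup>2"
      by (simp add: power_mult_distrib frob_norm_power2 l2_norm_power2 sum_distrib_left mult.commute)
    finally show "(l2_norm (M *\<^sub>v v))\<^sup>2 \<le> (frob_norm M * l2_norm v)\<^sup>2" .
  qed simp
qed simp

text \<open>The supremum is finite because the Frobenius norm is an operator bound.\<close>
lemma op_bound_spectral_norm:
  assumes "0 < dim_col M"
  shows "op_bound M (spectral_norm M)"
proof -
  let ?S = "{v \<in> carrier_vec (dim_col M). l2_norm v = 1}"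
  have bdd: "bdd_above ((\<lambda>v. l2_norm (M *\<^sub>v v)) ` ?S)"
    using op_bound_frob_norm[of M] by (intro bdd_aboveI[of _ "frob_norm M"]) (auto simp: op_bound_def)
  have unit: "l2_norm (M *\<^sub>v v) \<le> spectral_norm M" if "v \<in> ?S" for v
    unfolding spectral_norm_def using bdd that by (rule cSUP_upper2[OF _ _ order_refl])
  have "unit_vec (dim_col M) 0 \<in> ?S"
    using assms by (simp add: l2_norm_unit_vec)
  from unit[OF this] have "0 \<le> spectral_norm M" using l2_norm_nonneg order_trans by blast
  moreover have "l2_norm (M *\<^sub>v v) \<le> spectral_norm M * l2_norm v" if v: "v \<in> carrier_vec (dim_col M)" for v
  proof (cases "l2_norm v = 0")
    case True
    then have "v = 0\<^sub>v (dim_col M)" using v l2_norm_eq_0 by blast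
    moreover have "M *\<^sub>v 0\<^sub>v (dim_col M) = 0\<^sub>v (dim_row M)" by (rule eq_vecI) auto
    ultimately show ?thesis by simp
  next
    case False
    define u where "u = complex_of_real (1 / l2_norm v) \<cdot>\<^sub>v v"
    have "l2_norm u = 1" using False by (simp add: u_def l2_norm_smult norm_divide)
    then have "l2_norm (M *\<^sub>v u) \<le> spectral_norm M" using v by (intro unit) (simp add: u_def)
    moreover have "l2_norm (M *\<^sub>v u) = l2_norm (M *\<^sub>v v) / l2_norm v"
      using v by (simp add: u_def mult_mat_vec[of M "dim_row M" "dim_col M"] l2_norm_smult norm_divide)
    ultimately show ?thesis using False by (simp add: pos_divide_le_eq less_le)
  qed
  ultimately show ?thesis by (simp add: op_bound_def)
qed

section \<open>Isometries\<close>

lemma isometryD: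
  assumes "isometry N n \<Psi>"
  shows "\<Psi> \<in> carrier_mat N n" "mat_adjoint \<Psi> * \<Psi> = 1\<^sub>m n"
  using assms by (auto simp: isometry_def)

lemma isometry_op_bound:
  assumes "isometry N n \<Psi>"
  shows "op_bound \<Psi> 1"
  unfolding op_bound_def
proof (intro conjI ballI)
  note P = isometryD[OF assms]
  fix v :: "complex vec" assume "v \<in> carrier_vec (dim_col \<Psi>)"
  then have v: "v \<in> carrier_vec n" using P by auto
  have "complex_of_real ((l2_norm (\<Psi> *\<^sub>v v))\<^sup>2) = v \<bullet>c (mat_adjoint \<Psi> *\<^sub>v (\<Psi> *\<^sub>v v))"
    unfolding cscalar_prod_self[symmetric]
    by (rule cscalar_prod_adjoint[of _ N n]) (use P v in auto)
  also have "mat_adjoint \<Psi> *\<^sub>v (\<Psi> *\<^sub>v v) = v"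
    using P v by (simp add: assoc_mult_mat_vec[symmetric, of _ n N _ n])
  finally have "(l2_norm (\<Psi> *\<^sub>v v))\<^sup>2 = (l2_norm v)\<^sup>2"
    unfolding cscalar_prod_self by (simp only: of_real_eq_iff)
  then show "l2_norm (\<Psi> *\<^sub>v v) \<le> 1 * l2_norm v" by simp
qed simp

lemma isometry_cancel:
  assumes "isometry N n V" "X \<in> carrier_mat n m"
  shows "mat_adjoint V * (V * X) = X"
  using isometryD[OF assms(1)] assms(2) by (simp add: assoc_mult_mat_dim[symmetric])

lemma isometry_mult:
  assumes "isometry N k A" "isometry k n B"
  shows "isometry N n (A * B)"
proof -
  note A = isometryD[OF assms(1)] and B = isometryD[OF assms(2)]
  have "mat_adjoint (A * B) * (A * B) = mat_adjoint B * (mat_adjoint A * A) * B"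
    using A(1) B(1) by (simp add: mat_adjoint_mult[OF A(1) B(1)] assoc_mult_mat_dim)
  then show ?thesis using A B by (simp add: isometry_def)
qed

lemma isometry_square_unitary:
  assumes "isometry n n V"
  shows "V * mat_adjoint V = 1\<^sub>m n" "isometry n n (mat_adjoint V)"
  using mat_mult_left_right_inverse[of "mat_adjoint V" n V] isometryD[OF assms]
  by (auto simp: isometry_def)

lemma isometry_cancel_adjoint:
  assumes "isometry n n V" "X \<in> carrier_mat n m"
  shows "V * (mat_adjoint V * X) = X"
  using isometry_cancel[OF isometry_square_unitary(2)[OF assms(1)] assms(2)] by simp

lemma frob_norm_isometry_left:
  assumes "isometry N n \<Psi>" "M \<in> carrier_mat n m"
  shows "frob_norm (\<Psi> * M) = frob_norm M"
proof (rule antisym)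
  note P = isometryD[OF assms(1)]
  show "frob_norm (\<Psi> * M) \<le> frob_norm M"
    using frob_norm_mult_left[OF isometry_op_bound[OF assms(1)] P(1) assms(2)] by simp
  have "M = mat_adjoint \<Psi> * (\<Psi> * M)"
    using P assms by (simp add: assoc_mult_mat[symmetric, of _ n N _ n])
  then have "frob_norm M = frob_norm (mat_adjoint \<Psi> * (\<Psi> * M))" by simp
  also have "\<dots> \<le> 1 * frob_norm (\<Psi> * M)"
    using isometry_op_bound[OF assms(1), THEN op_bound_adjoint] P assms
    by (intro frob_norm_mult_left[of _ _ n N]) auto
  finally show "frob_norm M \<le> frob_norm (\<Psi> * M)" by simp
qed

lemma frob_norm_isometry_right:
  assumes "isometry N n \<Psi>" "M \<in> carrier_mat m n"
  shows "frob_norm (M * mat_adjoint \<Psi>) = frob_norm M"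
proof -
  have "mat_adjoint (M * mat_adjoint \<Psi>) = \<Psi> * mat_adjoint M"
    using isometryD[OF assms(1)] assms(2) by (subst mat_adjoint_mult[of _ m n _ N]) auto
  then show ?thesis
    using frob_norm_isometry_left[OF assms(1), of "mat_adjoint M" m] assms(2)
    by (metis frob_norm_adjoint mat_adjoint_carrier)
qed

section \<open>Orthonormal families and the spectral theorem for Hermitian matrices\<close>

text \<open>Vectors are indexed by arbitrary sets of numbers so that a family can be extended at any missing
  index, not only at the end.\<close>
definition orthonormal :: "nat \<Rightarrow> nat set \<Rightarrow> (nat \<Rightarrow> complex vec) \<Rightarrow> bool" where
  "orthonormal N S w \<longleftrightarrow> (\<forall>i\<in>S. w i \<in> carrier_vec N) \<and>
     (\<forall>i\<in>S. \<forall>j\<in>S. w i \<bullet>c w j = (if i = j then 1 else 0))"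

lemma adjoint_mult_index:
  fixes X :: "complex mat"
  assumes "X \<in> carrier_mat N m" "i < m" "j < m"
  shows "(mat_adjoint X * X) $$ (i, j) = col X j \<bullet>c col X i"
proof -
  have "(mat_adjoint X * X) $$ (i, j) = (\<Sum>l<N. X $$ (l, j) * cnj (X $$ (l, i)))"
    using assms by (subst mult_mat_index[of _ m N _ m]) (auto simp: mult.commute)
  also have "\<dots> = col X j \<bullet>c col X i"
    using assms by (subst cscalar_prod_sum[of _ N]) auto
  finally show ?thesis .
qed

lemma isometryI_orthonormal:
  assumes "X \<in> carrier_mat N m" "orthonormal N {..<m} (col X)"
  shows "isometry N m X"
  unfolding isometry_def
proof (intro conjI eq_matI)
  fix i j assume "i < dim_row (1\<^sub>m m)" "j < dim_col (1\<^sub>m m)"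
  then show "(mat_adjoint X * X) $$ (i, j) = 1\<^sub>m m $$ (i, j)"
    using assms adjoint_mult_index[of X N m i j] by (auto simp: orthonormal_def)
qed (use assms in auto)

lemma orthonormal_imp_isometry:
  assumes "orthonormal N {..<m} w"
  obtains W where "isometry N m W" "\<And>i. i < m \<Longrightarrow> col W i = w i"
proof
  define W where "W = Matrix.mat N m (\<lambda>(a, i). w i $ a)"
  have W: "W \<in> carrier_mat N m" by (simp add: W_def)
  show col: "col W i = w i" if "i < m" for i
  proof -
    have "dim_vec (w i) = N" using that assms by (auto simp: orthonormal_def)
    then show ?thesis using that by (intro eq_vecI) (auto simp: W_def)
  qed
  show "isometry N m W"
    using assms by (intro isometryI_orthonormal W) (auto simp: orthonormal_def col)
qed

text \<open>Fewer than \<open>N\<close> linear equations in \<open>N\<close> unknowns have a nonzero solution.\<close>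
lemma exists_unit_orthogonal:
  fixes w :: "nat \<Rightarrow> complex vec"
  assumes S: "finite S" "card S < N" and w: "\<And>i. i \<in> S \<Longrightarrow> w i \<in> carrier_vec N"
  shows "\<exists>u \<in> carrier_vec N. u \<bullet>c u = 1 \<and> (\<forall>i\<in>S. u \<bullet>c w i = 0)"
proof -
  obtain f where f: "bij_betw f {..<card S} S"
    using ex_bij_betw_nat_finite[OF S(1)] by (auto simp: atLeast0LessThan)
  define A where "A = Matrix.mat N N (\<lambda>(r, a). if r < card S then cnj (w (f r) $ a) else 0)"
  have A: "A \<in> carrier_mat N N" by (simp add: A_def)
  \<comment> \<open>The matrix of the orthogonality conditions is padded with zero rows, hence singular.\<close>
  have "transpose_mat A *\<^sub>v unit_vec N (N - 1) = 0\<^sub>v N"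
  proof (rule eq_vecI)
    fix i assume "i < dim_vec (0\<^sub>v N)"
    then have i: "i < N" by simp
    have "(transpose_mat A *\<^sub>v unit_vec N (N - 1)) $ i
        = (\<Sum>l<N. transpose_mat A $$ (i, l) * unit_vec N (N - 1) $ l)"
      using A i by (intro mult_mat_vec_index) auto
    also have "\<dots> = 0" using S i by (intro sum.neutral) (auto simp: A_def unit_vec_def)
    finally show "(transpose_mat A *\<^sub>v unit_vec N (N - 1)) $ i = 0\<^sub>v N $ i" using i by simp
  qed (use A in auto)
  moreover have "unit_vec N (N - 1) \<noteq> (0\<^sub>v N :: complex vec)"
    using S by (metis diff_less index_unit_vec(1) index_zero_vec(1) less_one neq0_conv not_less0 zero_neq_one)
  ultimately have "det (transpose_mat A) = 0"
    using A by (subst det_0_iff_vec_prod_zero[of _ N]) (auto intro!: exI[of _ "unit_vec N (N - 1)"])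
  then obtain v where v: "v \<in> carrier_vec N" "v \<noteq> 0\<^sub>v N" "A *\<^sub>v v = 0\<^sub>v N"
    using det_0_iff_vec_prod_zero[OF A] det_transpose[OF A] by auto
  have orth: "v \<bullet>c w i = 0" if "i \<in> S" for i
  proof -
    have "i \<in> f ` {..<card S}" using f that by (simp add: bij_betw_imp_surj_on)
    then obtain r where r: "r < card S" "f r = i" by auto
    have "0 = (A *\<^sub>v v) $ r" using v r S by simp
    also have "\<dots> = (\<Sum>l<N. A $$ (r, l) * v $ l)" using A v r S by (intro mult_mat_vec_index[of _ N N]) auto
    also have "\<dots> = v \<bullet>c w i"
      using r S w[OF that] by (subst cscalar_prod_sum[of _ N]) (auto simp: A_def mult.commute)
    finally show ?thesis by simp
  qed
  have pos: "l2_norm v \<noteq> 0" using v l2_norm_eq_0 by blast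
  define u where "u = complex_of_real (1 / l2_norm v) \<cdot>\<^sub>v v"
  have "l2_norm u = 1" using pos by (simp add: u_def l2_norm_smult norm_divide)
  then have "u \<bullet>c u = 1" unfolding cscalar_prod_self by simp
  moreover have "u \<bullet>c w i = 0" if "i \<in> S" for i
    using orth[OF that] v w[OF that] by (simp add: u_def)
  moreover have "u \<in> carrier_vec N" using v by (simp add: u_def)
  ultimately show ?thesis by blast
qed

text \<open>Otherwise the rows of \<open>\<Psi>\<close> leave room for a unit vector that \<open>\<Psi>\<close> maps to zero.\<close>
lemma isometry_imp_le:
  assumes "isometry N n \<Psi>"
  shows "n \<le> N"
proof (rule ccontr)
  assume "\<not> n \<le> N"
  then have lt: "N < n" by simp
  note P = isometryD[OF assms]
  obtain u where u: "u \<in> carrier_vec n" "u \<bullet>c u = 1" "\<forall>i\<in>{..<N}. u \<bullet>c conjugate (row \<Psi> i) = 0"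
    using exists_unit_orthogonal[of "{..<N}" n "\<lambda>i. conjugate (row \<Psi> i)"] lt P(1) by auto
  have "\<Psi> *\<^sub>v u = 0\<^sub>v N"
  proof (rule eq_vecI)
    fix i assume "i < dim_vec (0\<^sub>v N)"
    then have i: "i < N" by simp
    have "row \<Psi> i \<in> carrier_vec n" using P(1) i by auto
    then show "(\<Psi> *\<^sub>v u) $ i = 0\<^sub>v N $ i"
      using u i P(1) by (simp add: comm_scalar_prod[of _ n])
  qed (use P in auto)
  moreover have "u = mat_adjoint \<Psi> *\<^sub>v (\<Psi> *\<^sub>v u)"
    using P u by (simp add: assoc_mult_mat_vec[symmetric, of _ n N _ n])
  moreover have "mat_adjoint \<Psi> *\<^sub>v 0\<^sub>v N = 0\<^sub>v n" using P by (intro eq_vecI) auto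
  ultimately show False using u by simp
qed

text \<open>Needed twice: an eigenvector is completed to a unitary matrix in the spectral theorem, and the
  columns that belong to zero singular values are filled in to obtain isometries.\<close>
lemma orthonormal_extend:
  assumes "orthonormal N S w" "S \<subseteq> {..<m}" "m \<le> N"
  shows "\<exists>w'. orthonormal N {..<m} w' \<and> (\<forall>i\<in>S. w' i = w i)"
  using assms
proof (induction "card ({..<m} - S)" arbitrary: S w)
  case 0
  then have "S = {..<m}" by auto
  then show ?case using 0 by blast
next
  case (Suc c)
  then obtain k where k: "k < m" "k \<notin> S" by (metis Diff_iff card.empty ex_in_conv lessThan_iff nat.distinct(1))
  have fin: "finite S" using Suc.prems finite_subset by blast
  have "S \<subset> {..<m}" using k Suc.prems by auto
  then have "card S < N" using psubset_card_mono[of "{..<m}" S] Suc.prems by simp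
  then obtain u where u: "u \<in> carrier_vec N" "u \<bullet>c u = 1" "\<forall>i\<in>S. u \<bullet>c w i = 0"
    using exists_unit_orthogonal[OF fin, of N w] Suc.prems by (auto simp: orthonormal_def)
  have u': "w i \<bullet>c u = 0" if "i \<in> S" for i
  proof -
    have wi: "w i \<in> carrier_vec N" using that Suc.prems by (auto simp: orthonormal_def)
    have "w i \<bullet>c u = cnj (u \<bullet>c w i)"
      unfolding cscalar_prod_sum[OF wi] cscalar_prod_sum[OF u(1)] by (simp add: mult.commute)
    then show ?thesis using u that by simp
  qed
  have "orthonormal N (insert k S) (w(k := u))"
    using Suc.prems(1) u u' k unfolding orthonormal_def by auto
  moreover have "c = card ({..<m} - insert k S)"
    using Suc.hyps(2) k by (simp add: card_Diff_insert)
  ultimately obtain w' where "orthonormal N {..<m} w'" "\<forall>i\<in>insert k S. w' i = (w(k := u)) i"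
    using Suc.hyps(1)[of "insert k S" "w(k := u)"] Suc.prems k by auto
  then show ?case using k by (intro exI[of _ w']) auto
qed

text \<open>Induction on the dimension: an eigenvector is completed to a unitary matrix \<open>W\<close>. Then
  \<open>W\<^sup>* A W\<close> is Hermitian with first column \<open>e\<close> times the first unit vector, so its first row has the
  same shape, \<open>e\<close> is real, and the induction hypothesis diagonalizes the remaining block.\<close>
lemma hermitian_diagonalization:
  fixes A :: "complex mat"
  assumes "A \<in> carrier_mat n n" "mat_adjoint A = A"
  shows "\<exists>V d. isometry n n V \<and> A * V = V * mat_diag n (\<lambda>i. complex_of_real (d i))"
  using assms
proof (induction n arbitrary: A)
  case 0
  have "A * 1\<^sub>m 0 = 1\<^sub>m 0 * mat_diag 0 (\<lambda>i. complex_of_real 0)"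
    by (rule eq_matI) (simp_all add: carrier_matD[OF 0(1)] carrier_matD[OF mat_diag_dim])
  moreover have "isometry 0 0 (1\<^sub>m 0)" by (simp add: isometry_def)
  ultimately show ?case by (intro exI[of _ "1\<^sub>m 0"] exI[of _ "\<lambda>_. 0"] conjI)
next
  case (Suc n)
  note A = Suc.prems
  obtain as where as: "char_poly A = (\<Prod>a\<leftarrow>as. [:- a, 1:])" "length as = Suc n"
    using char_poly_factorized[OF A(1)] by blast
  then have "poly (char_poly A) (hd as) = 0" by (cases as) auto
  then have "eigenvalue A (hd as)" by (simp add: eigenvalue_root_char_poly[OF A(1)])
  then obtain v e where v: "v \<in> carrier_vec (Suc n)" "v \<noteq> 0\<^sub>v (Suc n)" "A *\<^sub>v v = e \<cdot>\<^sub>v v"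
    using A(1) unfolding eigenvalue_def eigenvector_def by auto
  define u where "u = complex_of_real (1 / l2_norm v) \<cdot>\<^sub>v v"
  have u: "u \<in> carrier_vec (Suc n)" using v by (simp add: u_def)
  have "l2_norm v \<noteq> 0" using v l2_norm_eq_0 by blast
  then have "l2_norm u = 1" by (simp add: u_def l2_norm_smult norm_divide)
  then have "orthonormal (Suc n) {0} (\<lambda>_. u)"
    using u by (simp add: orthonormal_def cscalar_prod_self)
  then obtain w where w: "orthonormal (Suc n) {..<Suc n} w" "w 0 = u"
    using orthonormal_extend[of "Suc n" "{0}" _ "Suc n"] by auto
  then obtain W where W: "isometry (Suc n) (Suc n) W" "col W 0 = u"
    using orthonormal_imp_isometry[of "Suc n" "Suc n" w] by (metis zero_less_Suc)
  note Wc = isometryD(1)[OF W(1)]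
  have Au: "A *\<^sub>v u = e \<cdot>\<^sub>v u"
    using v A by (simp add: u_def mult_mat_vec[of A "Suc n" "Suc n"] smult_smult_assoc mult.commute)
  define B where "B = mat_adjoint W * (A * W)"
  have B: "B \<in> carrier_mat (Suc n) (Suc n)" using Wc A(1) by (auto simp: B_def)
  have AW: "A * W = W * B"
    unfolding B_def by (rule isometry_cancel_adjoint[OF W(1), symmetric]) (use A Wc in auto)
  have herm: "mat_adjoint B = B"
    using Wc A by (simp add: B_def mat_adjoint_mult[of _ "Suc n" "Suc n" _ "Suc n"] assoc_mult_mat_dim)
  have herm_index: "B $$ (i, j) = cnj (B $$ (j, i))" if "i < Suc n" "j < Suc n" for i j
    using arg_cong[OF herm, of "\<lambda>X. X $$ (i, j)"] B that by simp
  \<comment> \<open>In the basis of the columns of \<open>W\<close>, the first one an eigenvector, \<open>A\<close> splits off a \<open>1 \<times> 1\<close> block.\<close>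
  have B0: "B $$ (i, 0) = (if i = 0 then e else 0)" if i: "i < Suc n" for i
  proof -
    have AW0: "(A * W) $$ (l, 0) = W $$ (l, 0) * e" if "l < Suc n" for l
    proof -
      have "(A * W) $$ (l, 0) = (A *\<^sub>v col W 0) $ l" using A Wc that by simp
      also have "\<dots> = e * W $$ (l, 0)" using W Au u Wc that by (metis carrier_matD carrier_vecD index_col index_smult_vec(1) zero_less_Suc)
      finally show ?thesis by simp
    qed
    have "B $$ (i, 0) = (\<Sum>l<Suc n. mat_adjoint W $$ (i, l) * (A * W) $$ (l, 0))"
      unfolding B_def using A Wc i by (intro mult_mat_index) auto
    also have "\<dots> = (\<Sum>l<Suc n. mat_adjoint W $$ (i, l) * W $$ (l, 0)) * e"
      unfolding sum_distrib_right by (intro sum.cong) (simp_all only: AW0 lessThan_iff mult.assoc)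
    also have "(\<Sum>l<Suc n. mat_adjoint W $$ (i, l) * W $$ (l, 0)) = (mat_adjoint W * W) $$ (i, 0)"
      using Wc i by (intro mult_mat_index[symmetric]) auto
    finally show ?thesis using isometryD(2)[OF W(1)] i by simp
  qed
  have B0': "B $$ (0, i) = (if i = 0 then e else 0)" if i: "i < Suc n" for i
    using herm_index[of 0 i] herm_index[of 0 0] B0[OF i] B0[of 0] i by (auto split: if_splits)
  have e: "e = complex_of_real (Re e)"
    using herm_index[of 0 0] B0[of 0] by (simp add: complex_eq_iff)
  define A' where "A' = Matrix.mat n n (\<lambda>(i, j). B $$ (Suc i, Suc j))"
  have A': "A' \<in> carrier_mat n n" by (simp add: A'_def)
  have "mat_adjoint A' = A'"
  proof (rule eq_matI)
    fix i j assume "i < dim_row A'" "j < dim_col A'"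
    then show "mat_adjoint A' $$ (i, j) = A' $$ (i, j)"
      using A' herm_index[of "Suc i" "Suc j"] by (simp add: A'_def)
  qed (use A' in simp_all)
  with Suc.IH[OF A'] obtain V' d' where V': "isometry n n V'"
      "A' * V' = V' * mat_diag n (\<lambda>i. complex_of_real (d' i))" by blast
  note V'c = isometryD(1)[OF V'(1)]
  define X where "X = Matrix.mat (Suc n) (Suc n) (\<lambda>(i, j).
      case (i, j) of (0, 0) \<Rightarrow> 1 | (Suc i', Suc j') \<Rightarrow> V' $$ (i', j') | _ \<Rightarrow> 0)"
  have X: "X \<in> carrier_mat (Suc n) (Suc n)" by (simp add: X_def)
  define d where "d = (\<lambda>i. case i of 0 \<Rightarrow> Re e | Suc i' \<Rightarrow> d' i')"
  have "isometry (Suc n) (Suc n) X"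
    unfolding isometry_def
  proof (intro conjI X eq_matI)
    fix i j assume "i < dim_row (1\<^sub>m (Suc n))" "j < dim_col (1\<^sub>m (Suc n))"
    then have ij: "i < Suc n" "j < Suc n" by auto
    have V'V': "(\<Sum>l<n. cnj (V' $$ (l, i)) * V' $$ (l, j)) = (if i = j then 1 else 0)"
      if "i < n" "j < n" for i j
      using arg_cong[OF isometryD(2)[OF V'(1)], of "\<lambda>X. X $$ (i, j)"] V'c that
      by (subst (asm) mult_mat_index[of _ n n _ n]) auto
    have "(mat_adjoint X * X) $$ (i, j) = (\<Sum>l<Suc n. cnj (X $$ (l, i)) * X $$ (l, j))"
      using X ij by (subst mult_mat_index[of _ "Suc n" "Suc n" _ "Suc n"]) auto
    also have "\<dots> = 1\<^sub>m (Suc n) $$ (i, j)"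
      unfolding sum.lessThan_Suc_shift using ij V'V'
      by (cases i; cases j) (auto simp: X_def)
    finally show "(mat_adjoint X * X) $$ (i, j) = 1\<^sub>m (Suc n) $$ (i, j)" .
  qed (use X in auto)
  moreover have BX: "B * X = X * mat_diag (Suc n) (\<lambda>i. complex_of_real (d i))"
  proof (rule eq_matI)
    fix i j
    assume "i < dim_row (X * mat_diag (Suc n) (\<lambda>i. complex_of_real (d i)))"
      "j < dim_col (X * mat_diag (Suc n) (\<lambda>i. complex_of_real (d i)))"
    then have ij: "i < Suc n" "j < Suc n" using X by (auto simp: mat_diag_def)
    have A'V': "(\<Sum>l<n. B $$ (Suc i, Suc l) * V' $$ (l, j)) = V' $$ (i, j) * complex_of_real (d' j)"
      if "i < n" "j < n" for i j
      using arg_cong[OF V'(2), of "\<lambda>X. X $$ (i, j)"] V'c A' that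
      by (subst (asm) mult_mat_index[of _ n n _ n]) (auto simp: mat_diag_mult_right[OF V'c] A'_def)
    have "(B * X) $$ (i, j) = (\<Sum>l<Suc n. B $$ (i, l) * X $$ (l, j))"
      using B X ij by (intro mult_mat_index)
    also have "\<dots> = X $$ (i, j) * complex_of_real (d j)"
      unfolding sum.lessThan_Suc_shift using ij A'V' B0 B0' e
      by (cases i; cases j) (auto simp: X_def d_def)
    finally show "(B * X) $$ (i, j) = (X * mat_diag (Suc n) (\<lambda>i. complex_of_real (d i))) $$ (i, j)"
      using ij by (simp add: mat_diag_mult_right[OF X])
  qed (use X B in \<open>auto simp: mat_diag_def\<close>)
  ultimately have "isometry (Suc n) (Suc n) (W * X)" using isometry_mult W(1) by blast
  moreover have "A * (W * X) = W * X * mat_diag (Suc n) (\<lambda>i. complex_of_real (d i))"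
  proof -
    have "A * (W * X) = (A * W) * X"
      using A Wc X by (simp add: assoc_mult_mat_dim)
    also have "\<dots> = W * (B * X)"
      unfolding AW using B Wc X by (simp add: assoc_mult_mat_dim)
    finally show ?thesis unfolding BX using Wc X
      by (simp add: assoc_mult_mat_dim mat_diag_def)
  qed
  ultimately show ?case by blast
qed

text \<open>The eigenvectors are permuted so that the eigenvalues appear in the order in which singular
  values are listed.\<close>
lemma hermitian_diagonalization_decreasing:
  fixes A :: "complex mat"
  assumes "A \<in> carrier_mat n n" "mat_adjoint A = A"
  obtains V d where "isometry n n V" "A * V = V * mat_diag n (\<lambda>i. complex_of_real (d i))"
    "\<And>i j. i \<le> j \<Longrightarrow> j < n \<Longrightarrow> d j \<le> d i"
proof -
  obtain V d where V: "isometry n n V" and AV: "A * V = V * mat_diag n (\<lambda>i. complex_of_real (d i))"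
    using hermitian_diagonalization[OF assms] by blast
  note Vc = isometryD(1)[OF V]
  define p where "p = sort_key (\<lambda>i. - d i) [0..<n]"
  have p: "length p = n" "distinct p" "set p = {..<n}" "sorted (map (\<lambda>i. - d i) p)"
    by (auto simp: p_def)
  have pn: "p ! i < n" if "i < n" for i using p that by (metis lessThan_iff nth_mem)
  define V' where "V' = Matrix.mat n n (\<lambda>(a, i). V $$ (a, p ! i))"
  have V'c: "V' \<in> carrier_mat n n" by (simp add: V'_def)
  have "isometry n n V'"
    unfolding isometry_def
  proof (intro conjI V'c eq_matI)
    fix i j assume "i < dim_row (1\<^sub>m n)" "j < dim_col (1\<^sub>m n)"
    then have ij: "i < n" "j < n" by auto
    have "(mat_adjoint V' * V') $$ (i, j) = (\<Sum>l<n. mat_adjoint V $$ (p ! i, l) * V $$ (l, p ! j))"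
      using V'c Vc ij pn by (subst mult_mat_index[of _ n n _ n]) (auto simp: V'_def)
    also have "\<dots> = (mat_adjoint V * V) $$ (p ! i, p ! j)"
      using Vc ij pn by (intro mult_mat_index[symmetric]) auto
    finally show "(mat_adjoint V' * V') $$ (i, j) = 1\<^sub>m n $$ (i, j)"
      using isometryD(2)[OF V] ij pn p by (simp add: nth_eq_iff_index_eq)
  qed (use V'c in auto)
  moreover have "A * V' = V' * mat_diag n (\<lambda>i. complex_of_real (d (p ! i)))"
  proof (rule eq_matI)
    fix i j
    assume "i < dim_row (V' * mat_diag n (\<lambda>i. complex_of_real (d (p ! i))))"
      "j < dim_col (V' * mat_diag n (\<lambda>i. complex_of_real (d (p ! i))))"
    then have ij: "i < n" "j < n" using V'c by (auto simp: mat_diag_def)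
    have "(A * V') $$ (i, j) = (\<Sum>l<n. A $$ (i, l) * V $$ (l, p ! j))"
      using assms V'c ij by (subst mult_mat_index[of _ n n _ n]) (auto simp: V'_def)
    also have "\<dots> = (A * V) $$ (i, p ! j)"
      using assms Vc ij pn by (intro mult_mat_index[symmetric]) auto
    finally show "(A * V') $$ (i, j) = (V' * mat_diag n (\<lambda>i. complex_of_real (d (p ! i)))) $$ (i, j)"
      unfolding AV mat_diag_mult_right[OF Vc] mat_diag_mult_right[OF V'c]
      using ij pn by (simp add: V'_def)
  qed (use V'c assms in \<open>auto simp: mat_diag_def\<close>)
  moreover have "d (p ! j) \<le> d (p ! i)" if "i \<le> j" "j < n" for i j
    using sorted_nth_mono[OF p(4) that(1)] that p(1) by simp
  ultimately show thesis by (rule that)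
qed

section \<open>Singular value decompositions\<close>

lemma mat_adjoint_mult_self_carrier:
  "M \<in> carrier_mat N m \<Longrightarrow> mat_adjoint M * M \<in> carrier_mat m m"
  for M :: "complex mat"
  by auto

lemma proots_char_poly_diagonalization:
  fixes d :: "nat \<Rightarrow> real"
  assumes A: "A \<in> carrier_mat n n" and V: "isometry n n V"
    and AV: "A * V = V * mat_diag n (\<lambda>i. complex_of_real (d i))"
  shows "proots (char_poly A) = mset (map (\<lambda>i. complex_of_real (d i)) [0..<n])"
proof -
  let ?D = "mat_diag n (\<lambda>i. complex_of_real (d i))"
  note Vc = isometryD(1)[OF V]
  have D: "?D \<in> carrier_mat n n" by simp
  have "A = A * (V * mat_adjoint V)"
    using isometry_square_unitary(1)[OF V] A by simp
  also have "\<dots> = A * V * mat_adjoint V" using A Vc by (simp add: assoc_mult_mat_dim)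
  finally have "A = V * ?D * mat_adjoint V" unfolding AV .
  then have "similar_mat_wit A ?D V (mat_adjoint V)"
    using isometry_square_unitary(1)[OF V] isometryD[OF V] A by (intro similar_mat_witI) auto
  then have "char_poly A = char_poly ?D"
    by (intro char_poly_similar) (auto simp: similar_mat_def)
  also have "\<dots> = (\<Prod>a\<leftarrow>diag_mat ?D. [:- a, 1:])"
    by (rule char_poly_upper_triangular[OF D]) (auto simp: mat_diag_def)
  also have "diag_mat ?D = map (\<lambda>i. complex_of_real (d i)) [0..<n]"
    by (auto simp: diag_mat_def mat_diag_def)
  finally have cp: "char_poly A = (\<Prod>a\<leftarrow>map (\<lambda>i. complex_of_real (d i)) [0..<n]. [:- a, 1:])" .
  have "proots (\<Prod>a\<leftarrow>xs. [:- a, 1:]) = mset xs" for xs :: "complex list"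
  proof (induction xs)
    case (Cons a xs)
    have "proots ([:- a, 1:] * (\<Prod>a\<leftarrow>xs. [:- a, 1:]))
        = proots [:- a, 1:] + proots (\<Prod>a\<leftarrow>xs. [:- a, 1:])"
      by (intro proots_mult) (auto simp: prod_list_zero_iff)
    then show ?case using Cons.IH by (simp del: mult_pCons_left)
  qed simp
  then show ?thesis unfolding cp .
qed

text \<open>Singular values are defined through roots of a characteristic polynomial; this is the bridge from
  any unitary diagonalization of \<open>M\<^sup>* M\<close> with decreasing entries.\<close>
lemma singular_values_eqI:
  fixes \<sigma> :: "nat \<Rightarrow> real"
  assumes M: "M \<in> carrier_mat N m" and V: "isometry m m V"
    and eq: "mat_adjoint M * M * V = V * mat_diag m (\<lambda>i. complex_of_real ((\<sigma> i)\<^sup>2))"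
    and nonneg: "\<And>i. i < m \<Longrightarrow> 0 \<le> \<sigma> i"
    and dec: "\<And>i j. i \<le> j \<Longrightarrow> j < m \<Longrightarrow> \<sigma> j \<le> \<sigma> i"
  shows "singular_values M = take (min N m) (map \<sigma> [0..<m])"
proof -
  have "proots (char_poly (mat_adjoint M * M)) = mset (map (\<lambda>i. complex_of_real ((\<sigma> i)\<^sup>2)) [0..<m])"
    by (rule proots_char_poly_diagonalization[OF mat_adjoint_mult_self_carrier[OF M] V eq])
  then have "image_mset (\<lambda>z. sqrt (Re z)) (proots (char_poly (mat_adjoint M * M)))
      = mset (map ((\<lambda>z. sqrt (Re z)) \<circ> (\<lambda>i. complex_of_real ((\<sigma> i)\<^sup>2))) [0..<m])"
    by (simp only: mset_map[symmetric] map_map)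
  also have "map ((\<lambda>z. sqrt (Re z)) \<circ> (\<lambda>i. complex_of_real ((\<sigma> i)\<^sup>2))) [0..<m] = map \<sigma> [0..<m]"
    using nonneg by auto
  also have "mset (map \<sigma> [0..<m]) = mset (rev (map \<sigma> [0..<m]))" by (simp only: mset_rev)
  finally have "sorted_list_of_multiset (image_mset (\<lambda>z. sqrt (Re z)) (proots (char_poly (mat_adjoint M * M))))
      = sort (rev (map \<sigma> [0..<m]))"
    by (simp only: sorted_list_of_multiset_mset)
  also have "\<dots> = rev (map \<sigma> [0..<m])"
    using dec by (intro sorted_sort_id) (auto simp: sorted_wrt_iff_nth_less rev_nth)
  finally show ?thesis using M by (simp add: singular_values_def)
qed

lemma gram_diagonalization:
  assumes "M \<in> carrier_mat N m" "isometry m m V"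
    "mat_adjoint M * M * V = V * mat_diag m f"
  shows "mat_adjoint (M * V) * (M * V) = mat_diag m f"
proof -
  note Vc = isometryD(1)[OF assms(2)]
  have "mat_adjoint (M * V) * (M * V) = mat_adjoint V * (mat_adjoint M * M * V)"
    using assms(1) Vc by (simp add: mat_adjoint_mult[OF assms(1) Vc] assoc_mult_mat_dim)
  also have "\<dots> = mat_diag m f"
    unfolding assms(3) by (rule isometry_cancel[OF assms(2) mat_diag_dim])
  finally show ?thesis .
qed

text \<open>The columns that are scaled by \<open>1 / \<sigma> i\<close> with \<open>\<sigma> i = 0\<close> are zero in \<open>Z\<close>, so that the
  convention \<open>1 / 0 = 0\<close> does no harm.\<close>
lemma normalize_orthogonal_columns:
  fixes \<sigma> :: "nat \<Rightarrow> real"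
  assumes Z: "Z \<in> carrier_mat N m"
    and gram: "mat_adjoint Z * Z = mat_diag m (\<lambda>i. complex_of_real ((\<sigma> i)\<^sup>2))"
  obtains Y where "Y \<in> carrier_mat N m" "Z = Y * mat_diag m (\<lambda>i. complex_of_real (\<sigma> i))"
    "\<And>i j. i < m \<Longrightarrow> j < m \<Longrightarrow> col Y i \<bullet>c col Y j = (if i = j \<and> \<sigma> i \<noteq> 0 then 1 else 0)"
proof
  let ?Y = "Matrix.mat N m (\<lambda>(a, i). complex_of_real (1 / \<sigma> i) * Z $$ (a, i))"
  show Y: "?Y \<in> carrier_mat N m" by simp
  have colZ: "col Z i \<bullet>c col Z j = (if i = j then complex_of_real ((\<sigma> i)\<^sup>2) else 0)"
    if "i < m" "j < m" for i j
    using adjoint_mult_index[OF Z that(2,1)] that by (auto simp: gram mat_diag_def)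
  have zero: "Z $$ (a, i) = 0" if "\<sigma> i = 0" "a < N" "i < m" for a i
  proof -
    have "col Z i \<in> carrier_vec N" using Z by auto
    moreover have "col Z i \<bullet>c col Z i = 0" using colZ that by simp
    ultimately have "col Z i = 0\<^sub>v N" using conjugate_square_eq_0_vec by blast
    then show ?thesis using that Z by (metis carrier_matD index_col index_zero_vec(1))
  qed
  show "Z = ?Y * mat_diag m (\<lambda>i. complex_of_real (\<sigma> i))"
    unfolding mat_diag_mult_right[OF Y] using Z zero by (intro eq_matI) auto
  show "col ?Y i \<bullet>c col ?Y j = (if i = j \<and> \<sigma> i \<noteq> 0 then 1 else 0)" if ij: "i < m" "j < m" for i j
  proof -
    have c: "col ?Y k = complex_of_real (1 / \<sigma> k) \<cdot>\<^sub>v col Z k" if "k < m" for k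
      using Z that by (intro eq_vecI) auto
    have Zc: "col Z k \<in> carrier_vec N" for k using Z by auto
    have "col ?Y i \<bullet>c col ?Y j = complex_of_real (1 / \<sigma> i) * complex_of_real (1 / \<sigma> j) * (col Z i \<bullet>c col Z j)"
      unfolding c[OF ij(1)] c[OF ij(2)] using Zc
      by (simp add: conjugate_smult_vec mult_ac)
    then show ?thesis using ij by (simp add: colZ power2_eq_square)
  qed
qed

lemma l2_norm_orthogonal_columns:
  fixes p :: "nat \<Rightarrow> real"
  assumes Z: "Z \<in> carrier_mat N m"
    and gram: "mat_adjoint Z * Z = mat_diag m (\<lambda>i. complex_of_real (p i))"
    and v: "v \<in> carrier_vec m"
  shows "(l2_norm (Z *\<^sub>v v))\<^sup>2 = (\<Sum>i<m. p i * (cmod (v $ i))\<^sup>2)"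
proof -
  let ?D = "mat_diag m (\<lambda>i. complex_of_real (p i))"
  have Dv: "(?D *\<^sub>v v) $ i = complex_of_real (p i) * v $ i" if "i < m" for i
  proof -
    have "(?D *\<^sub>v v) $ i = (\<Sum>l<m. ?D $$ (i, l) * v $ l)"
      using that v by (intro mult_mat_vec_index) auto
    also have "\<dots> = (\<Sum>l<m. if i = l then complex_of_real (p i) * v $ i else 0)"
      using that by (intro sum.cong) (auto simp: mat_diag_def)
    finally show ?thesis using that by simp
  qed
  have "complex_of_real ((l2_norm (Z *\<^sub>v v))\<^sup>2) = v \<bullet>c (mat_adjoint Z *\<^sub>v (Z *\<^sub>v v))"
    unfolding cscalar_prod_self[symmetric]
    by (rule cscalar_prod_adjoint[of _ N m]) (use Z v in auto)
  also have "mat_adjoint Z *\<^sub>v (Z *\<^sub>v v) = ?D *\<^sub>v v"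
    using Z v by (simp add: assoc_mult_mat_vec[symmetric, of _ m N _ m] gram)
  also have "v \<bullet>c (?D *\<^sub>v v) = (\<Sum>i<m. v $ i * cnj ((?D *\<^sub>v v) $ i))"
    by (rule cscalar_prod_sum) (rule mult_mat_vec_carrier[OF mat_diag_dim v])
  also have "\<dots> = (\<Sum>i<m. complex_of_real (p i * (cmod (v $ i))\<^sup>2))"
  proof (intro sum.cong refl)
    fix i assume "i \<in> {..<m}"
    then show "v $ i * cnj ((?D *\<^sub>v v) $ i) = complex_of_real (p i * (cmod (v $ i))\<^sup>2)"
      using Dv[of i] unfolding of_real_mult complex_norm_square by simp
  qed
  finally show ?thesis unfolding of_real_sum[symmetric] of_real_eq_iff .
qed

lemma op_bound_normalized_columns:
  assumes Y: "Y \<in> carrier_mat N m"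
    and gram: "\<And>i j. i < m \<Longrightarrow> j < m \<Longrightarrow> col Y i \<bullet>c col Y j = (if i = j \<and> P i then 1 else 0)"
  shows "op_bound Y 1"
  unfolding op_bound_def
proof (intro conjI ballI)
  have D: "mat_adjoint Y * Y = mat_diag m (\<lambda>i. complex_of_real (if P i then 1 else 0))"
    using Y by (intro eq_matI) (auto simp: adjoint_mult_index[OF Y] gram mat_diag_def simp del: index_mult_mat(1))
  fix v :: "complex vec" assume "v \<in> carrier_vec (dim_col Y)"
  then have v: "v \<in> carrier_vec m" using Y by auto
  have "(l2_norm (Y *\<^sub>v v))\<^sup>2 = (\<Sum>i<m. (if P i then 1 else 0) * (cmod (v $ i))\<^sup>2)"
    by (rule l2_norm_orthogonal_columns[OF Y D v])
  also have "\<dots> \<le> (l2_norm v)\<^sup>2"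
    using v by (auto simp: l2_norm_power2 intro: sum_mono)
  finally show "l2_norm (Y *\<^sub>v v) \<le> 1 * l2_norm v"
    by (simp add: power2_le_iff_abs_le)
qed simp

text \<open>Where \<open>\<sigma> i = 0\<close> the \<open>i\<close>-th column of \<open>W\<close> is arbitrary, so it can be chosen to complete an
  orthonormal family as long as there is enough room.\<close>
lemma isometric_factor:
  fixes \<sigma> :: "nat \<Rightarrow> real"
  assumes Z: "Z \<in> carrier_mat N m"
    and gram: "mat_adjoint Z * Z = mat_diag m (\<lambda>i. complex_of_real ((\<sigma> i)\<^sup>2))"
    and size: "m \<le> N \<or> (\<forall>i<m. \<sigma> i \<noteq> 0)"
  obtains W where "isometry N m W" "Z = W * mat_diag m (\<lambda>i. complex_of_real (\<sigma> i))"
proof -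
  obtain Y where Y: "Y \<in> carrier_mat N m" "Z = Y * mat_diag m (\<lambda>i. complex_of_real (\<sigma> i))"
    "\<And>i j. i < m \<Longrightarrow> j < m \<Longrightarrow> col Y i \<bullet>c col Y j = (if i = j \<and> \<sigma> i \<noteq> 0 then 1 else 0)"
    using normalize_orthogonal_columns[OF Z gram] by blast
  define S where "S = {i. i < m \<and> \<sigma> i \<noteq> 0}"
  have S: "S \<subseteq> {..<m}" "orthonormal N S (col Y)"
    using Y by (auto simp: S_def orthonormal_def)
  obtain w where w: "orthonormal N {..<m} w" "\<forall>i\<in>S. w i = col Y i"
  proof (cases "m \<le> N")
    case True
    then show ?thesis using orthonormal_extend[OF S(2,1)] that by blast
  next
    case False
    then have "S = {..<m}" using size by (auto simp: S_def)
    then show ?thesis using that[of "col Y"] S(2) by simp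
  qed
  then obtain W where W: "isometry N m W" "\<And>i. i < m \<Longrightarrow> col W i = w i"
    using orthonormal_imp_isometry by blast
  note Wc = isometryD(1)[OF W(1)]
  have "Z = W * mat_diag m (\<lambda>i. complex_of_real (\<sigma> i))"
    unfolding Y(2) mat_diag_mult_right[OF Wc] mat_diag_mult_right[OF Y(1)]
  proof (rule cong_mat)
    fix a i assume "a < N" "i < m"
    moreover have "W $$ (a, i) = Y $$ (a, i)" if "\<sigma> i \<noteq> 0"
      using that W(2) w(2) Wc Y(1) \<open>a < N\<close> \<open>i < m\<close> S_def
      by (metis (mono_tags, lifting) carrier_matD index_col mem_Collect_eq)
    ultimately show "(case (a, i) of (i, j) \<Rightarrow> Y $$ (i, j) * complex_of_real (\<sigma> j))
        = (case (a, i) of (i, j) \<Rightarrow> W $$ (i, j) * complex_of_real (\<sigma> j))"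
      by (cases "\<sigma> i = 0") simp_all
  qed simp_all
  with W(1) show thesis by (rule that)
qed

lemma gram_diagonalization_sqrt:
  fixes M :: "complex mat"
  assumes M: "M \<in> carrier_mat N m"
  obtains V and \<sigma> :: "nat \<Rightarrow> real" where "isometry m m V"
    "mat_adjoint M * M * V = V * mat_diag m (\<lambda>i. complex_of_real ((\<sigma> i)\<^sup>2))"
    "mat_adjoint (M * V) * (M * V) = mat_diag m (\<lambda>i. complex_of_real ((\<sigma> i)\<^sup>2))"
    "\<And>i. i < m \<Longrightarrow> 0 \<le> \<sigma> i" "\<And>i j. i \<le> j \<Longrightarrow> j < m \<Longrightarrow> \<sigma> j \<le> \<sigma> i"
proof -
  have "mat_adjoint (mat_adjoint M * M) = mat_adjoint M * M"
    using M by (subst mat_adjoint_mult[of _ m N _ m]) auto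
  then obtain V d where V: "isometry m m V"
    and d: "mat_adjoint M * M * V = V * mat_diag m (\<lambda>i. complex_of_real (d i))"
      "\<And>i j. i \<le> j \<Longrightarrow> j < m \<Longrightarrow> d j \<le> d i"
    using hermitian_diagonalization_decreasing[OF mat_adjoint_mult_self_carrier[OF M]] by metis
  note Vc = isometryD(1)[OF V]
  have MV: "M * V \<in> carrier_mat N m" using M Vc by auto
  have gram: "mat_adjoint (M * V) * (M * V) = mat_diag m (\<lambda>i. complex_of_real (d i))"
    by (rule gram_diagonalization[OF M V d(1)])
  have d_eq: "d i = (l2_norm (col (M * V) i))\<^sup>2" if "i < m" for i
  proof -
    have "complex_of_real (d i) = col (M * V) i \<bullet>c col (M * V) i"
      using adjoint_mult_index[OF MV that that] that by (simp add: gram mat_diag_def)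
    then show ?thesis unfolding cscalar_prod_self of_real_eq_iff .
  qed
  define \<sigma> where "\<sigma> = (\<lambda>i. sqrt (d i))"
  have \<sigma>: "(\<sigma> i)\<^sup>2 = d i" if "i < m" for i using d_eq[OF that] by (simp add: \<sigma>_def)
  have diag: "mat_diag m (\<lambda>i. complex_of_real (d i)) = mat_diag m (\<lambda>i. complex_of_real ((\<sigma> i)\<^sup>2))"
    unfolding mat_diag_def by (rule cong_mat) (auto simp: \<sigma>)
  have nonneg: "0 \<le> \<sigma> i" if "i < m" for i using d_eq[OF that] by (simp add: \<sigma>_def)
  have dec: "\<sigma> j \<le> \<sigma> i" if "i \<le> j" "j < m" for i j using d(2)[OF that] by (simp add: \<sigma>_def)
  show thesis
    by (rule that[OF V d(1)[unfolded diag] gram[unfolded diag] nonneg dec])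
qed

text \<open>All \<open>m\<close> values \<open>\<sigma> i\<close> are kept even if \<open>N < m\<close>. In this case \<open>W\<close> cannot be an isometry, but it
  still is a contraction, because its nonzero columns are orthonormal, and this is enough for the trace
  inequality below.\<close>
lemma singular_value_decomposition:
  assumes M: "M \<in> carrier_mat N m"
  obtains V W and \<sigma> :: "nat \<Rightarrow> real" where
    "isometry m m V" "W \<in> carrier_mat N m" "op_bound W 1"
    "M = W * mat_diag m (\<lambda>i. complex_of_real (\<sigma> i)) * mat_adjoint V"
    "\<And>i. i < m \<Longrightarrow> 0 \<le> \<sigma> i" "\<And>i j. i \<le> j \<Longrightarrow> j < m \<Longrightarrow> \<sigma> j \<le> \<sigma> i"
    "singular_values M = take (min N m) (map \<sigma> [0..<m])"
    "(frob_norm M)\<^sup>2 = (\<Sum>i<m. (\<sigma> i)\<^sup>2)"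
proof -
  obtain V \<sigma> where V: "isometry m m V"
    and eq: "mat_adjoint M * M * V = V * mat_diag m (\<lambda>i. complex_of_real ((\<sigma> i)\<^sup>2))"
    and gram: "mat_adjoint (M * V) * (M * V) = mat_diag m (\<lambda>i. complex_of_real ((\<sigma> i)\<^sup>2))"
    and nonneg: "\<And>i. i < m \<Longrightarrow> 0 \<le> \<sigma> i" and dec: "\<And>i j. i \<le> j \<Longrightarrow> j < m \<Longrightarrow> \<sigma> j \<le> \<sigma> i"
    using gram_diagonalization_sqrt[OF M] by metis
  note Vc = isometryD(1)[OF V]
  have MV: "M * V \<in> carrier_mat N m" using M Vc by auto
  have norms: "(l2_norm (col (M * V) i))\<^sup>2 = (\<sigma> i)\<^sup>2" if "i < m" for i
  proof -
    have "complex_of_real ((\<sigma> i)\<^sup>2) = col (M * V) i \<bullet>c col (M * V) i"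
      using adjoint_mult_index[OF MV that that] that by (simp add: gram mat_diag_def)
    then show ?thesis unfolding cscalar_prod_self of_real_eq_iff ..
  qed
  obtain Y where Y: "Y \<in> carrier_mat N m" "M * V = Y * mat_diag m (\<lambda>i. complex_of_real (\<sigma> i))"
    "\<And>i j. i < m \<Longrightarrow> j < m \<Longrightarrow> col Y i \<bullet>c col Y j = (if i = j \<and> \<sigma> i \<noteq> 0 then 1 else 0)"
    using normalize_orthogonal_columns[OF MV gram] by blast
  show thesis
  proof (rule that[OF V Y(1)])
    show "op_bound Y 1" by (rule op_bound_normalized_columns[OF Y(1,3)])
    have "M = M * (V * mat_adjoint V)" using isometry_square_unitary(1)[OF V] M by simp
    also have "\<dots> = M * V * mat_adjoint V" using M Vc by (simp add: assoc_mult_mat_dim)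
    finally show "M = Y * mat_diag m (\<lambda>i. complex_of_real (\<sigma> i)) * mat_adjoint V" unfolding Y(2) .
    show "singular_values M = take (min N m) (map \<sigma> [0..<m])"
      using eq nonneg dec by (rule singular_values_eqI[OF M V])
    have "frob_norm M = frob_norm (M * V)"
      using frob_norm_isometry_right[OF isometry_square_unitary(2)[OF V] M] by simp
    then show "(frob_norm M)\<^sup>2 = (\<Sum>i<m. (\<sigma> i)\<^sup>2)"
      using Vc by (simp add: frob_norm_power2_cols norms)
  qed (use nonneg dec in auto)
qed

lemma singular_values_nth:
  assumes "singular_values M = take r (map \<sigma> [0..<m])" "r \<le> m" "1 \<le> k" "k \<le> r"
  shows "sing_val M k = \<sigma> (k - 1)"
  using assms by (simp add: sing_val_def)

section \<open>Perturbation of singular values\<close>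

text \<open>Summation by parts.\<close>
lemma sum_decreasing_mult_nonneg:
  fixes \<sigma> x :: "nat \<Rightarrow> real"
  assumes nonneg: "\<And>i. i < n \<Longrightarrow> 0 \<le> \<sigma> i"
    and dec: "\<And>i j. i \<le> j \<Longrightarrow> j < n \<Longrightarrow> \<sigma> j \<le> \<sigma> i"
    and partial: "\<And>k. k \<le> n \<Longrightarrow> 0 \<le> (\<Sum>i<k. x i)"
  shows "0 \<le> (\<Sum>i<n. \<sigma> i * x i)"
proof (cases n)
  case (Suc n')
  have "\<sigma> k * (\<Sum>i<Suc k. x i) \<le> (\<Sum>i<Suc k. \<sigma> i * x i)" if "k < n" for k
    using that
  proof (induction k)
    case (Suc k)
    have "\<sigma> (Suc k) * (\<Sum>i<Suc k. x i) \<le> \<sigma> k * (\<Sum>i<Suc k. x i)"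
      using dec[of k "Suc k"] partial[of "Suc k"] Suc.prems by (intro mult_right_mono) auto
    then have "\<sigma> (Suc k) * (\<Sum>i<Suc k. x i) \<le> (\<Sum>i<Suc k. \<sigma> i * x i)"
      using Suc by linarith
    then show ?case by (simp add: algebra_simps)
  qed simp
  from this[of n'] show ?thesis
    using nonneg[of n'] partial[of n] Suc by (meson lessI mult_nonneg_nonneg order_refl order_trans)
qed simp

lemma sum_decreasing_mult_mono:
  fixes \<sigma> x y :: "nat \<Rightarrow> real"
  assumes "\<And>i. i < n \<Longrightarrow> 0 \<le> \<sigma> i" "\<And>i j. i \<le> j \<Longrightarrow> j < n \<Longrightarrow> \<sigma> j \<le> \<sigma> i"
    and "\<And>k. k \<le> n \<Longrightarrow> (\<Sum>i<k. x i) \<le> (\<Sum>i<k. y i)"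
  shows "(\<Sum>i<n. \<sigma> i * x i) \<le> (\<Sum>i<n. \<sigma> i * y i)"
  using sum_decreasing_mult_nonneg[of n \<sigma> "\<lambda>i. y i - x i"] assms
  by (simp add: sum_subtractf right_diff_distrib)

text \<open>Among all matrices with row and column sums at most 1, the identity maximizes the sum for
  decreasing weights. Summation by parts in \<open>i\<close> reduces this to partial sums over \<open>i < k\<close>; there the
  column sums of \<open>S\<close> are at most 1 and add up to at most \<open>k\<close>, and summation by parts in \<open>j\<close> finishes.\<close>
lemma substochastic_sum_le:
  fixes \<sigma> \<tau> :: "nat \<Rightarrow> real"
  assumes nm: "n \<le> m"
    and \<sigma>: "\<And>i. i < n \<Longrightarrow> 0 \<le> \<sigma> i" "\<And>i j. i \<le> j \<Longrightarrow> j < n \<Longrightarrow> \<sigma> j \<le> \<sigma> i"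
    and \<tau>: "\<And>i. i < m \<Longrightarrow> 0 \<le> \<tau> i" "\<And>i j. i \<le> j \<Longrightarrow> j < m \<Longrightarrow> \<tau> j \<le> \<tau> i"
    and S: "\<And>i j. 0 \<le> S i j" "\<And>i. i < n \<Longrightarrow> (\<Sum>j<m. S i j) \<le> 1" "\<And>j. j < m \<Longrightarrow> (\<Sum>i<n. S i j) \<le> 1"
  shows "(\<Sum>i<n. \<Sum>j<m. \<sigma> i * \<tau> j * S i j) \<le> (\<Sum>i<n. \<sigma> i * \<tau> i)"
proof -
  have "(\<Sum>i<n. \<sigma> i * (\<Sum>j<m. \<tau> j * S i j)) \<le> (\<Sum>i<n. \<sigma> i * \<tau> i)"
  proof (rule sum_decreasing_mult_mono[OF \<sigma>])
    fix k assume k: "k \<le> n"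
    have "(\<Sum>i<k. \<Sum>j<m. \<tau> j * S i j) = (\<Sum>j<m. \<tau> j * (\<Sum>i<k. S i j))"
      unfolding sum_distrib_left by (rule sum.swap)
    also have "\<dots> \<le> (\<Sum>j<m. \<tau> j * (if j < k then 1 else 0))"
    proof (rule sum_decreasing_mult_mono[OF \<tau>])
      fix l assume l: "l \<le> m"
      have "(\<Sum>j<l. \<Sum>i<k. S i j) \<le> (\<Sum>j<l. 1)"
      proof (rule sum_mono)
        fix j assume "j \<in> {..<l}"
        then show "(\<Sum>i<k. S i j) \<le> 1"
          using sum_mono2[of "{..<n}" "{..<k}" "\<lambda>i. S i j"] S(1) S(3)[of j] k l by fastforce
      qed
      moreover have "(\<Sum>j<l. \<Sum>i<k. S i j) \<le> (\<Sum>i<k. 1)"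
        unfolding sum.swap[of _ "{..<k}"]
      proof (rule sum_mono)
        fix i assume "i \<in> {..<k}"
        then show "(\<Sum>j<l. S i j) \<le> 1"
          using sum_mono2[of "{..<m}" "{..<l}" "S i"] S(1) S(2)[of i] k l by fastforce
      qed
      moreover have "(\<Sum>j<l. if j < k then 1 else 0 :: real) = real (min l k)"
      proof -
        have "{..<l} \<inter> {j. j < k} = {..<min l k}" by auto
        then show ?thesis by (simp add: sum.If_cases)
      qed
      ultimately show "(\<Sum>j<l. \<Sum>i<k. S i j) \<le> (\<Sum>j<l. if j < k then 1 else 0)" by simp
    qed
    also have "\<dots> = (\<Sum>j<k. \<tau> j)"
    proof -
      have "{..<m} \<inter> {j. j < k} = {..<k}" using k nm by auto
      then show ?thesis by (simp add: if_distrib[of "\<lambda>x. _ * x"] sum.If_cases)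
    qed
    finally show "(\<Sum>i<k. \<Sum>j<m. \<tau> j * S i j) \<le> (\<Sum>i<k. \<tau> i)" .
  qed
  then show ?thesis by (simp add: sum_distrib_left mult.assoc)
qed

lemma op_bound_col:
  assumes "op_bound K 1" "K \<in> carrier_mat N m" "i < m"
  shows "(\<Sum>j<N. (cmod (K $$ (j, i)))\<^sup>2) \<le> 1"
proof -
  have "K *\<^sub>v unit_vec m i = col K i" using assms by (intro eq_vecI) auto
  then have "l2_norm (col K i) \<le> 1"
    using op_boundD[OF assms(1,2), of "unit_vec m i"] assms(3) by (simp add: l2_norm_unit_vec)
  then have "(l2_norm (col K i))\<^sup>2 \<le> 1" by (simp add: power_le_one)
  then show ?thesis using assms by (simp add: l2_norm_power2)
qed

lemma op_bound_row:
  assumes "op_bound K 1" "K \<in> carrier_mat N m" "j < N"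
  shows "(\<Sum>i<m. (cmod (K $$ (j, i)))\<^sup>2) \<le> 1"
proof -
  have "(\<Sum>i<m. (cmod (K $$ (j, i)))\<^sup>2) = (\<Sum>i<m. (cmod (mat_adjoint K $$ (i, j)))\<^sup>2)"
    using assms by (intro sum.cong) auto
  also have "\<dots> \<le> 1"
    by (rule op_bound_col[OF op_bound_adjoint[OF assms(1)]]) (use assms in auto)
  finally show ?thesis .
qed

lemma mult_diag_adjoint_index:
  assumes "W \<in> carrier_mat N n" "V \<in> carrier_mat M n" "a < N" "b < M"
  shows "(W * mat_diag n f * mat_adjoint V) $$ (a, b) = (\<Sum>i<n. W $$ (a, i) * f i * cnj (V $$ (b, i)))"
  using assms
  by (subst mult_mat_index[of _ N n _ M]) (auto simp: mat_diag_mult_right intro!: sum.cong)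

text \<open>Von Neumann's trace inequality. Expanding both decompositions, the inner product becomes
  \<open>\<Sum> \<sigma>\<^sub>i \<tau>\<^sub>j F\<^sub>j\<^sub>i cnj G\<^sub>j\<^sub>i\<close> with the contractions \<open>F = X\<^sup>* W\<close> and \<open>G = Y\<^sup>* V\<close>. The numbers
  \<open>(\<bar>F\<^sub>j\<^sub>i\<bar>\<^sup>2 + \<bar>G\<^sub>j\<^sub>i\<bar>\<^sup>2) / 2\<close> form a doubly substochastic matrix, since rows and columns of a contraction have
  length at most 1.\<close>
lemma von_Neumann_trace_le:
  fixes \<sigma> \<tau> :: "nat \<Rightarrow> real"
  assumes nm: "n \<le> m"
    and \<sigma>: "\<And>i. i < n \<Longrightarrow> 0 \<le> \<sigma> i" "\<And>i j. i \<le> j \<Longrightarrow> j < n \<Longrightarrow> \<sigma> j \<le> \<sigma> i"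
    and \<tau>: "\<And>i. i < m \<Longrightarrow> 0 \<le> \<tau> i" "\<And>i j. i \<le> j \<Longrightarrow> j < m \<Longrightarrow> \<tau> j \<le> \<tau> i"
    and W: "W \<in> carrier_mat N n" "op_bound W 1" and V: "V \<in> carrier_mat M n" "op_bound V 1"
    and X: "X \<in> carrier_mat N m" "op_bound X 1" and Y: "Y \<in> carrier_mat M m" "op_bound Y 1"
    and A: "A = W * mat_diag n (\<lambda>i. complex_of_real (\<sigma> i)) * mat_adjoint V"
    and B: "B = X * mat_diag m (\<lambda>i. complex_of_real (\<tau> i)) * mat_adjoint Y"
  shows "Re (\<Sum>a<N. \<Sum>b<M. A $$ (a, b) * cnj (B $$ (a, b))) \<le> (\<Sum>i<n. \<sigma> i * \<tau> i)"
proof -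
  define F where "F = mat_adjoint X * W"
  define G where "G = mat_adjoint Y * V"
  have F: "F \<in> carrier_mat m n" "op_bound F 1"
    using op_bound_mult[OF op_bound_adjoint[OF X(2)] _ W(2,1)] X(1) W(1) by (auto simp: F_def)
  have G: "G \<in> carrier_mat m n" "op_bound G 1"
    using op_bound_mult[OF op_bound_adjoint[OF Y(2)] _ V(2,1)] Y(1) V(1) by (auto simp: G_def)
  have F_index: "F $$ (j, i) = (\<Sum>a<N. cnj (X $$ (a, j)) * W $$ (a, i))" if "i < n" "j < m" for i j
    unfolding F_def using that X(1) W(1) by (subst mult_mat_index[of _ m N _ n]) auto
  have G_index: "G $$ (j, i) = (\<Sum>b<M. cnj (Y $$ (b, j)) * V $$ (b, i))" if "i < n" "j < m" for i j
    unfolding G_def using that Y(1) V(1) by (subst mult_mat_index[of _ m M _ n]) auto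
  have Re_real_mult: "Re (complex_of_real r * z) = r * Re z" for r z by simp
  let ?t = "\<lambda>a b i j. (W $$ (a, i) * complex_of_real (\<sigma> i) * cnj (V $$ (b, i)))
      * cnj (X $$ (a, j) * complex_of_real (\<tau> j) * cnj (Y $$ (b, j)))"
  have "(\<Sum>a<N. \<Sum>b<M. A $$ (a, b) * cnj (B $$ (a, b))) = (\<Sum>a<N. \<Sum>b<M. \<Sum>i<n. \<Sum>j<m. ?t a b i j)"
    by (intro sum.cong refl)
      (simp add: A B mult_diag_adjoint_index[OF W(1) V(1)] mult_diag_adjoint_index[OF X(1) Y(1)]
        sum_product del: index_mult_mat)
  also have "\<dots> = (\<Sum>a<N. \<Sum>i<n. \<Sum>b<M. \<Sum>j<m. ?t a b i j)"
    by (rule sum.cong[OF refl], rule sum.swap)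
  also have "\<dots> = (\<Sum>i<n. \<Sum>a<N. \<Sum>b<M. \<Sum>j<m. ?t a b i j)"
    by (rule sum.swap)
  also have "\<dots> = (\<Sum>i<n. \<Sum>a<N. \<Sum>j<m. \<Sum>b<M. ?t a b i j)"
    by (rule sum.cong[OF refl], rule sum.cong[OF refl], rule sum.swap)
  also have "\<dots> = (\<Sum>i<n. \<Sum>j<m. \<Sum>a<N. \<Sum>b<M. ?t a b i j)"
    by (rule sum.cong[OF refl], rule sum.swap)
  also have "\<dots> = (\<Sum>i<n. \<Sum>j<m. complex_of_real (\<sigma> i * \<tau> j) * (F $$ (j, i) * cnj (G $$ (j, i))))"
  proof (intro sum.cong refl)
    fix i j assume "i \<in> {..<n}" "j \<in> {..<m}"
    then have "F $$ (j, i) * cnj (G $$ (j, i))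
        = (\<Sum>a<N. cnj (X $$ (a, j)) * W $$ (a, i)) * (\<Sum>b<M. Y $$ (b, j) * cnj (V $$ (b, i)))"
      by (simp add: F_index G_index)
    also have "\<dots> = (\<Sum>a<N. \<Sum>b<M. (cnj (X $$ (a, j)) * W $$ (a, i)) * (Y $$ (b, j) * cnj (V $$ (b, i))))"
      by (rule sum_product)
    finally show "(\<Sum>a<N. \<Sum>b<M. ?t a b i j)
        = complex_of_real (\<sigma> i * \<tau> j) * (F $$ (j, i) * cnj (G $$ (j, i)))"
      by (simp add: sum_distrib_left mult_ac)
  qed
  finally have eq: "(\<Sum>a<N. \<Sum>b<M. A $$ (a, b) * cnj (B $$ (a, b)))
      = (\<Sum>i<n. \<Sum>j<m. complex_of_real (\<sigma> i * \<tau> j) * (F $$ (j, i) * cnj (G $$ (j, i))))" .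
  have "Re (\<Sum>a<N. \<Sum>b<M. A $$ (a, b) * cnj (B $$ (a, b)))
      = (\<Sum>i<n. \<Sum>j<m. \<sigma> i * \<tau> j * Re (F $$ (j, i) * cnj (G $$ (j, i))))"
    unfolding eq Re_sum Re_real_mult ..
  also have "\<dots> \<le> (\<Sum>i<n. \<Sum>j<m. \<sigma> i * \<tau> j * (((cmod (F $$ (j, i)))\<^sup>2 + (cmod (G $$ (j, i)))\<^sup>2) / 2))"
  proof (intro sum_mono mult_left_mono)
    fix i j
    have "Re (F $$ (j, i) * cnj (G $$ (j, i))) \<le> cmod (F $$ (j, i)) * cmod (G $$ (j, i))"
      by (metis complex_Re_le_cmod complex_mod_cnj norm_mult)
    also have "\<dots> \<le> ((cmod (F $$ (j, i)))\<^sup>2 + (cmod (G $$ (j, i)))\<^sup>2) / 2"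
      using sum_squares_bound[of "cmod (F $$ (j, i))" "cmod (G $$ (j, i))"] by simp
    finally show "Re (F $$ (j, i) * cnj (G $$ (j, i))) \<le> \<dots>" .
  qed (use \<sigma> \<tau> in auto)
  also have "\<dots> \<le> (\<Sum>i<n. \<sigma> i * \<tau> i)"
  proof (rule substochastic_sum_le[OF nm \<sigma> \<tau>])
    fix i assume i: "i < n"
    show "(\<Sum>j<m. ((cmod (F $$ (j, i)))\<^sup>2 + (cmod (G $$ (j, i)))\<^sup>2) / 2) \<le> 1"
      using op_bound_col[OF F(2,1) i] op_bound_col[OF G(2,1) i]
      unfolding sum_divide_distrib[symmetric] sum.distrib by simp
  next
    fix j assume j: "j < m"
    show "(\<Sum>i<n. ((cmod (F $$ (j, i)))\<^sup>2 + (cmod (G $$ (j, i)))\<^sup>2) / 2) \<le> 1"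
      using op_bound_row[OF F(2,1) j] op_bound_row[OF G(2,1) j]
      unfolding sum_divide_distrib[symmetric] sum.distrib by simp
  qed auto
  finally show ?thesis .
qed

lemma frob_norm_diff_power2:
  assumes "A \<in> carrier_mat N M" "B \<in> carrier_mat N M"
  shows "(frob_norm (A - B))\<^sup>2 = (frob_norm A)\<^sup>2 + (frob_norm B)\<^sup>2
    - 2 * Re (\<Sum>a<N. \<Sum>b<M. A $$ (a, b) * cnj (B $$ (a, b)))"
proof -
  have *: "(cmod (x - y))\<^sup>2 = (cmod x)\<^sup>2 + (cmod y)\<^sup>2 - 2 * Re (x * cnj y)" for x y
    unfolding cmod_power2 by (simp add: power2_eq_square algebra_simps)
  have "(frob_norm (A - B))\<^sup>2 = (\<Sum>a<N. \<Sum>b<M. (cmod (A $$ (a, b) - B $$ (a, b)))\<^sup>2)"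
    using assms by (simp add: frob_norm_power2)
  also have "\<dots> = (frob_norm A)\<^sup>2 + (frob_norm B)\<^sup>2
      - 2 * Re (\<Sum>a<N. \<Sum>b<M. A $$ (a, b) * cnj (B $$ (a, b)))"
    using assms unfolding frob_norm_power2 Re_sum *
    by (simp add: sum.distrib sum_subtractf sum_distrib_left)
  finally show ?thesis .
qed

text \<open>Mirsky's theorem for \<open>\<Psi> H \<Phi>\<^sup>*\<close> and \<open>B\<close>, with the singular values of the first matrix read off
  from \<open>H\<close>: a singular value decomposition of \<open>H\<close> is carried over by the isometries, so only
  \<open>n\<close> terms occur on this side, and those of \<open>B\<close> beyond the \<open>n\<close>-th can only increase the right-hand side.\<close>
lemma Mirsky_isometries:
  assumes H: "H \<in> carrier_mat n n" and B: "B \<in> carrier_mat N M"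
    and \<Psi>: "isometry N n \<Psi>" and \<Phi>: "isometry M n \<Phi>" and le: "n \<le> N" "n \<le> M"
  shows "sqrt (\<Sum>k=1..n. (sing_val H k - sing_val B k)\<^sup>2) \<le> frob_norm (B - \<Psi> * H * mat_adjoint \<Phi>)"
proof -
  note \<Psi>c = isometryD(1)[OF \<Psi>] and \<Phi>c = isometryD(1)[OF \<Phi>]
  obtain V W \<sigma> where V: "isometry n n V" and W: "W \<in> carrier_mat n n" "op_bound W 1"
    and H_eq: "H = W * mat_diag n (\<lambda>i. complex_of_real (\<sigma> i)) * mat_adjoint V"
    and \<sigma>: "\<And>i. i < n \<Longrightarrow> 0 \<le> \<sigma> i" "\<And>i j. i \<le> j \<Longrightarrow> j < n \<Longrightarrow> \<sigma> j \<le> \<sigma> i"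
    and sv_H: "singular_values H = take (min n n) (map \<sigma> [0..<n])"
    and H_norm: "(frob_norm H)\<^sup>2 = (\<Sum>i<n. (\<sigma> i)\<^sup>2)"
    using singular_value_decomposition[OF H] by metis
  obtain Y X \<tau> where Y: "isometry M M Y" and X: "X \<in> carrier_mat N M" "op_bound X 1"
    and B_eq: "B = X * mat_diag M (\<lambda>i. complex_of_real (\<tau> i)) * mat_adjoint Y"
    and \<tau>: "\<And>i. i < M \<Longrightarrow> 0 \<le> \<tau> i" "\<And>i j. i \<le> j \<Longrightarrow> j < M \<Longrightarrow> \<tau> j \<le> \<tau> i"
    and sv_B: "singular_values B = take (min N M) (map \<tau> [0..<M])"
    and B_norm: "(frob_norm B)\<^sup>2 = (\<Sum>i<M. (\<tau> i)\<^sup>2)"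
    using singular_value_decomposition[OF B] by metis
  note Vc = isometryD(1)[OF V] and Yc = isometryD(1)[OF Y]
  define A where "A = \<Psi> * H * mat_adjoint \<Phi>"
  have A: "A \<in> carrier_mat N M" using \<Psi>c \<Phi>c H by (auto simp: A_def)
  have A_eq: "A = (\<Psi> * W) * mat_diag n (\<lambda>i. complex_of_real (\<sigma> i)) * mat_adjoint (\<Phi> * V)"
    using \<Psi>c \<Phi>c W Vc
    by (simp add: A_def H_eq mat_adjoint_mult[OF \<Phi>c Vc] assoc_mult_mat_dim
      carrier_matD[OF mat_diag_dim])
  have "frob_norm A = frob_norm (\<Psi> * H)"
    unfolding A_def by (rule frob_norm_isometry_right[OF \<Phi>]) (use \<Psi>c H in auto)
  also have "\<dots> = frob_norm H" by (rule frob_norm_isometry_left[OF \<Psi> H])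
  finally have A_norm: "(frob_norm A)\<^sup>2 = (\<Sum>i<n. (\<sigma> i)\<^sup>2)" using H_norm by simp
  have "op_bound (\<Psi> * W) 1" using op_bound_mult[OF isometry_op_bound[OF \<Psi>] \<Psi>c W(2,1)] by simp
  moreover have "op_bound (\<Phi> * V) 1" by (rule isometry_op_bound[OF isometry_mult[OF \<Phi> V]])
  ultimately have "Re (\<Sum>a<N. \<Sum>b<M. A $$ (a, b) * cnj (B $$ (a, b))) \<le> (\<Sum>i<n. \<sigma> i * \<tau> i)"
    by (intro von_Neumann_trace_le[OF le(2) \<sigma> \<tau> mult_carrier_mat[OF \<Psi>c W(1)] _
          mult_carrier_mat[OF \<Phi>c Vc] _ X Yc isometry_op_bound[OF Y] A_eq B_eq])
  moreover have "(\<Sum>i<n. (\<tau> i)\<^sup>2) \<le> (\<Sum>i<M. (\<tau> i)\<^sup>2)"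
    using le by (intro sum_mono2) auto
  ultimately have "(\<Sum>i<n. (\<sigma> i)\<^sup>2) + (\<Sum>i<n. (\<tau> i)\<^sup>2) - 2 * (\<Sum>i<n. \<sigma> i * \<tau> i) \<le> (frob_norm (A - B))\<^sup>2"
    using A_norm B_norm frob_norm_diff_power2[OF A B] by simp
  then have "(\<Sum>i<n. (\<sigma> i - \<tau> i)\<^sup>2) \<le> (frob_norm (A - B))\<^sup>2"
    by (simp add: power2_diff sum.distrib sum_subtractf sum_distrib_left mult.assoc)
  moreover have "(\<Sum>i<n. (\<sigma> i - \<tau> i)\<^sup>2) = (\<Sum>k=1..n. (sing_val H k - sing_val B k)\<^sup>2)"
  proof -
    have "(\<Sum>k=1..n. (sing_val H k - sing_val B k)\<^sup>2) = (\<Sum>k=1..n. (\<sigma> (k - 1) - \<tau> (k - 1))\<^sup>2)"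
      using le by (intro sum.cong refl)
        (simp add: singular_values_nth[OF sv_H] singular_values_nth[OF sv_B])
    also have "\<dots> = (\<Sum>i<n. (\<sigma> i - \<tau> i)\<^sup>2)"
      by (rule sum.reindex_bij_witness[of _ Suc "\<lambda>k. k - 1"]) auto
    finally show ?thesis ..
  qed
  moreover have "frob_norm (A - B) = frob_norm (B - A)"
    by (rule frob_norm_minus_commute[OF A B])
  ultimately show ?thesis
    unfolding A_def by (intro real_le_lsqrt) (auto intro: sum_nonneg)
qed

section \<open>Perturbation of square root factors\<close>

lemma injective_imp_inverse:
  fixes A :: "complex mat"
  assumes A: "A \<in> carrier_mat n n"
    and inj: "\<And>v. v \<in> carrier_vec n \<Longrightarrow> A *\<^sub>v v = 0\<^sub>v n \<Longrightarrow> v = 0\<^sub>v n"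
  obtains K where "K \<in> carrier_mat n n" "K * A = 1\<^sub>m n" "A * K = 1\<^sub>m n"
proof -
  have "det A \<noteq> 0" using inj by (auto simp: det_0_iff_vec_prod_zero[OF A])
  then have "A \<in> Units (ring_mat TYPE(complex) n ())" by (rule det_non_zero_imp_unit[OF A])
  then show thesis using that by (auto simp: Units_def ring_mat_simps)
qed

text \<open>For \<open>P = X X\<^sup>*\<close> the singular values are the eigenvalues of \<open>P\<close>, so \<open>sigma_min P\<close> is the minimum of
  the quadratic form \<open>\<langle>v, P v\<rangle> = \<parallel>X\<^sup>* v\<parallel>\<^sup>2\<close> on unit vectors.\<close>
lemma smallest_singular_value_gram:
  fixes X :: "complex mat"
  assumes X: "X \<in> carrier_mat n k" and n: "1 \<le> n"
  shows "0 \<le> sigma_min (X * mat_adjoint X)"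
    and "\<And>v. v \<in> carrier_vec n \<Longrightarrow>
      sigma_min (X * mat_adjoint X) * (l2_norm v)\<^sup>2 \<le> (l2_norm (mat_adjoint X *\<^sub>v v))\<^sup>2"
    and "sigma_min (X * mat_adjoint X) = 0 \<Longrightarrow> \<not> invertible_mat (X * mat_adjoint X)"
proof -
  let ?P = "X * mat_adjoint X"
  have X': "mat_adjoint X \<in> carrier_mat k n" using X by simp
  have P: "?P \<in> carrier_mat n n" using X by auto
  obtain V \<sigma> where V: "isometry n n V"
    and eq: "?P * V = V * mat_diag n (\<lambda>i. complex_of_real ((\<sigma> i)\<^sup>2))"
    and gram: "mat_adjoint (mat_adjoint X * V) * (mat_adjoint X * V)
        = mat_diag n (\<lambda>i. complex_of_real ((\<sigma> i)\<^sup>2))"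
    and nonneg: "\<And>i. i < n \<Longrightarrow> 0 \<le> \<sigma> i" and dec: "\<And>i j. i \<le> j \<Longrightarrow> j < n \<Longrightarrow> \<sigma> j \<le> \<sigma> i"
    using gram_diagonalization_sqrt[OF X'] unfolding mat_adjoint_adjoint by metis
  note Vc = isometryD(1)[OF V]
  have "mat_adjoint ?P = ?P" by (simp add: mat_adjoint_mult[OF X X'])
  then have "mat_adjoint ?P * ?P * V = ?P * (?P * V)"
    using P Vc X by (simp add: assoc_mult_mat_dim)
  also have "\<dots> = ?P * V * mat_diag n (\<lambda>i. complex_of_real ((\<sigma> i)\<^sup>2))"
    by (simp only: eq assoc_mult_mat[OF P Vc mat_diag_dim, symmetric])
  also have "\<dots> = V * mat_diag n (\<lambda>i. complex_of_real (((\<sigma> i)\<^sup>2)\<^sup>2))"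
    unfolding eq using Vc
    by (simp add: assoc_mult_mat[OF Vc mat_diag_dim mat_diag_dim] power2_eq_square[of "(_ :: complex)\<^sup>2"])
  finally have "singular_values ?P = take (min n n) (map (\<lambda>i. (\<sigma> i)\<^sup>2) [0..<n])"
    using nonneg dec by (intro singular_values_eqI[OF P V]) (auto intro: power_mono)
  then have sm: "sigma_min ?P = (\<sigma> (n - 1))\<^sup>2"
    using n by (simp add: sigma_min_def last_map)
  show "0 \<le> sigma_min ?P" by (simp add: sm)
  show "sigma_min ?P * (l2_norm v)\<^sup>2 \<le> (l2_norm (mat_adjoint X *\<^sub>v v))\<^sup>2" if v: "v \<in> carrier_vec n" for v
  proof -
    define y where "y = mat_adjoint V *\<^sub>v v"
    have y: "y \<in> carrier_vec n" using Vc v by (auto simp: y_def intro: mult_mat_vec_carrier)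
    have Vy: "V *\<^sub>v y = v"
      using Vc v isometry_square_unitary(1)[OF V]
      by (simp add: y_def assoc_mult_mat_vec[symmetric, of _ n n _ n])
    have Xy: "mat_adjoint X *\<^sub>v v = (mat_adjoint X * V) *\<^sub>v y"
      using X' Vc y by (simp add: assoc_mult_mat_vec[of _ k n _ n] Vy)
    have "l2_norm v \<le> 1 * l2_norm y"
      using op_boundD[OF isometry_op_bound[OF V] Vc y] by (simp add: Vy)
    then have "sigma_min ?P * (l2_norm v)\<^sup>2 \<le> (\<sigma> (n - 1))\<^sup>2 * (l2_norm y)\<^sup>2"
      unfolding sm by (intro mult_left_mono power_mono) auto
    also have "\<dots> = (\<Sum>i<n. (\<sigma> (n - 1))\<^sup>2 * (cmod (y $ i))\<^sup>2)"
      using y by (simp add: l2_norm_power2 sum_distrib_left)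
    also have "\<dots> \<le> (\<Sum>i<n. (\<sigma> i)\<^sup>2 * (cmod (y $ i))\<^sup>2)"
    proof (intro sum_mono mult_right_mono power_mono)
      fix i assume "i \<in> {..<n}"
      then show "\<sigma> (n - 1) \<le> \<sigma> i" using dec[of i "n - 1"] by auto
    qed (use nonneg[of "n - 1"] n in auto)
    also have "\<dots> = (l2_norm (mat_adjoint X *\<^sub>v v))\<^sup>2"
      unfolding Xy by (rule l2_norm_orthogonal_columns[OF _ gram y, symmetric]) (use X' Vc in auto)
    finally show ?thesis .
  qed
  show "\<not> invertible_mat ?P" if zero: "sigma_min ?P = 0"
  proof
    assume "invertible_mat ?P"
    then obtain B where B_inv: "?P * B = 1\<^sub>m (dim_row ?P)" "B * ?P = 1\<^sub>m (dim_row B)"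
      by (auto simp: invertible_mat_def inverts_mat_def)
    have "dim_row B = n" "dim_col B = n"
      using arg_cong[OF B_inv(2), of dim_col] arg_cong[OF B_inv(1), of dim_col] X by simp_all
    then have B: "B \<in> carrier_mat n n" and BP: "B * ?P = 1\<^sub>m n"
      using B_inv(2) by (auto intro: carrier_matI)
    have "V = B * (?P * V)"
      using BP B P Vc by (simp add: assoc_mult_mat[OF B P Vc, symmetric])
    then have "V $$ (i, n - 1) = 0" if "i < n" for i
    proof -
      have "(?P * V) $$ (l, n - 1) = 0" if "l < n" for l
        unfolding eq mat_diag_mult_right[OF Vc] using that n zero sm by simp
      moreover have "(B * (?P * V)) $$ (i, n - 1) = (\<Sum>l<n. B $$ (i, l) * (?P * V) $$ (l, n - 1))"
        by (rule mult_mat_index[OF B mult_carrier_mat[OF P Vc]]) (use that n in auto)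
      ultimately have "(B * (?P * V)) $$ (i, n - 1) = 0" by simp
      then show ?thesis using \<open>V = B * (?P * V)\<close> by argo
    qed
    then have "(\<Sum>l<n. mat_adjoint V $$ (n - 1, l) * V $$ (l, n - 1)) = 0" by simp
    moreover have "(\<Sum>l<n. mat_adjoint V $$ (n - 1, l) * V $$ (l, n - 1)) = (mat_adjoint V * V) $$ (n - 1, n - 1)"
      by (rule mult_mat_index[symmetric, of _ n n _ n]) (use Vc n in auto)
    ultimately show False using isometryD(2)[OF V] n by simp
  qed
qed

lemma frob_norm_diag: "(frob_norm (mat_diag n f))\<^sup>2 = (\<Sum>i<n. (cmod (f i))\<^sup>2)"
proof -
  have "(\<Sum>j<n. (cmod (mat_diag n f $$ (i, j)))\<^sup>2) = (cmod (f i))\<^sup>2" if "i < n" for i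
  proof -
    have "(\<Sum>j<n. (cmod (mat_diag n f $$ (i, j)))\<^sup>2) = (\<Sum>j<n. if i = j then (cmod (f i))\<^sup>2 else 0)"
      using that by (intro sum.cong) (auto simp: mat_diag_def)
    then show ?thesis using that by simp
  qed
  then show ?thesis by (simp add: frob_norm_power2 carrier_matD[OF mat_diag_dim])
qed

text \<open>Both \<open>U\<^sup>*\<close> and \<open>W\<^sup>*\<close> have singular value decompositions with the same singular values and the same right
  singular vectors; \<open>\<Psi>\<close> maps the left singular vectors of one to those of the other.\<close>
lemma same_gram_isometry:
  fixes U W :: "complex mat"
  assumes U: "U \<in> carrier_mat n n" and W: "W \<in> carrier_mat n N" and le: "n \<le> N"
    and eq: "U * mat_adjoint U = W * mat_adjoint W"
  obtains \<Psi> where "isometry N n \<Psi>" "W = U * mat_adjoint \<Psi>"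
proof -
  have U': "mat_adjoint U \<in> carrier_mat n n" and W': "mat_adjoint W \<in> carrier_mat N n"
    using U W by auto
  obtain V \<sigma> where V: "isometry n n V"
    and diag: "U * mat_adjoint U * V = V * mat_diag n (\<lambda>i. complex_of_real ((\<sigma> i)\<^sup>2))"
    and gramU: "mat_adjoint (mat_adjoint U * V) * (mat_adjoint U * V)
        = mat_diag n (\<lambda>i. complex_of_real ((\<sigma> i)\<^sup>2))"
    using gram_diagonalization_sqrt[OF U'] unfolding mat_adjoint_adjoint by metis
  note Vc = isometryD(1)[OF V]
  let ?D = "mat_diag n (\<lambda>i. complex_of_real (\<sigma> i))"
  have gramW: "mat_adjoint (mat_adjoint W * V) * (mat_adjoint W * V)
      = mat_diag n (\<lambda>i. complex_of_real ((\<sigma> i)\<^sup>2))"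
    using diag by (intro gram_diagonalization[OF W' V]) (simp add: eq)
  obtain Y where Y: "isometry n n Y" "mat_adjoint U * V = Y * ?D"
    by (rule isometric_factor[OF mult_carrier_mat[OF U' Vc] gramU]) auto
  obtain Z where Z: "isometry N n Z" "mat_adjoint W * V = Z * ?D"
    by (rule isometric_factor[OF mult_carrier_mat[OF W' Vc] gramW]) (use le in auto)
  note Yc = isometryD(1)[OF Y(1)] and Zc = isometryD(1)[OF Z(1)]
  let ?\<Psi> = "Z * mat_adjoint Y"
  have \<Psi>: "isometry N n ?\<Psi>" by (rule isometry_mult[OF Z(1) isometry_square_unitary(2)[OF Y(1)]])
  have "?\<Psi> * (mat_adjoint U * V) = Z * (mat_adjoint Y * (Y * ?D))"
    unfolding Y(2) using Zc Yc by (intro assoc_mult_mat) auto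
  also have "\<dots> = mat_adjoint W * V"
    unfolding Z(2) by (simp add: isometry_cancel[OF Y(1) mat_diag_dim])
  finally have "?\<Psi> * (mat_adjoint U * V) * mat_adjoint V = mat_adjoint W * V * mat_adjoint V" by simp
  then have "?\<Psi> * (mat_adjoint U * (V * mat_adjoint V)) = mat_adjoint W * (V * mat_adjoint V)"
    using Zc Yc U' W' Vc by (simp add: assoc_mult_mat_dim)
  then have "?\<Psi> * mat_adjoint U = mat_adjoint W"
    using U W by (simp add: isometry_square_unitary(1)[OF V])
  then have "mat_adjoint (?\<Psi> * mat_adjoint U) = W" by simp
  then have "W = U * mat_adjoint ?\<Psi>"
    by (simp add: mat_adjoint_mult[OF isometryD(1)[OF \<Psi>] U'])
  with \<Psi> show thesis by (rule that)
qed

text \<open>\<open>\<Psi>\<^sup>*\<close> is the isometric factor of the polar decomposition of \<open>M\<close>. With \<open>\<sigma> i\<close> the singular values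
  of \<open>M\<close>, the distances are the Euclidean norms of \<open>\<sigma> i - 1\<close> and of \<open>(\<sigma> i)\<^sup>2 - 1\<close>, and
  \<open>\<bar>\<sigma> - 1\<bar> \<le> \<bar>\<sigma> - 1\<bar> (\<sigma> + 1)\<close>. That \<open>\<epsilon> < 1\<close> forces \<open>\<sigma> i \<noteq> 0\<close>, hence \<open>n \<le> N\<close>.\<close>
lemma near_coisometry:
  fixes M :: "complex mat"
  assumes M: "M \<in> carrier_mat n N" and \<epsilon>: "\<epsilon> < 1"
    and near: "frob_norm (M * mat_adjoint M - 1\<^sub>m n) \<le> \<epsilon>"
  obtains \<Psi> where "isometry N n \<Psi>" "frob_norm (M - mat_adjoint \<Psi>) \<le> \<epsilon>"
proof -
  have M': "mat_adjoint M \<in> carrier_mat N n" using M by simp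
  have MM: "M * mat_adjoint M \<in> carrier_mat n n" using M by auto
  obtain V \<sigma> where V: "isometry n n V"
    and diag: "M * mat_adjoint M * V = V * mat_diag n (\<lambda>i. complex_of_real ((\<sigma> i)\<^sup>2))"
    and gram: "mat_adjoint (mat_adjoint M * V) * (mat_adjoint M * V)
        = mat_diag n (\<lambda>i. complex_of_real ((\<sigma> i)\<^sup>2))"
    and nonneg: "\<And>i. i < n \<Longrightarrow> 0 \<le> \<sigma> i"
    using gram_diagonalization_sqrt[OF M'] unfolding mat_adjoint_adjoint by metis
  note Vc = isometryD(1)[OF V]
  let ?D = "mat_diag n (\<lambda>i. complex_of_real (\<sigma> i))"
  let ?R = "mat_diag n (\<lambda>i. complex_of_real ((\<sigma> i)\<^sup>2 - 1))"
  have "(M * mat_adjoint M - 1\<^sub>m n) * V = M * mat_adjoint M * V - 1\<^sub>m n * V"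
    by (rule minus_mult_distrib_mat[OF MM one_carrier_mat Vc])
  also have "\<dots> = V * ?R"
    unfolding diag mat_diag_mult_right[OF Vc] using Vc
    by (intro eq_matI) (auto simp: algebra_simps)
  finally have "frob_norm (V * ?R) = frob_norm (M * mat_adjoint M - 1\<^sub>m n)"
    using frob_norm_isometry_right[OF isometry_square_unitary(2)[OF V]
        minus_carrier_mat[OF one_carrier_mat], of "M * mat_adjoint M"]
    by simp
  then have "frob_norm ?R \<le> \<epsilon>" using frob_norm_isometry_left[OF V mat_diag_dim, of "\<lambda>i. complex_of_real ((\<sigma> i)\<^sup>2 - 1)"] near by simp
  moreover from this have \<epsilon>0: "0 \<le> \<epsilon>" using frob_norm_nonneg order_trans by blast
  ultimately have sum_R: "(\<Sum>i<n. \<bar>(\<sigma> i)\<^sup>2 - 1\<bar>\<^sup>2) \<le> \<epsilon>\<^sup>2"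
    using power_mono[of "frob_norm ?R" \<epsilon> 2] unfolding frob_norm_diag by (simp add: norm_of_real del: of_real_diff)
  have pos: "\<sigma> i \<noteq> 0" if "i < n" for i
  proof
    assume "\<sigma> i = 0"
    then have "1 \<le> (\<Sum>i<n. \<bar>(\<sigma> i)\<^sup>2 - 1\<bar>\<^sup>2)"
      using member_le_sum[of i "{..<n}" "\<lambda>i. \<bar>(\<sigma> i)\<^sup>2 - 1\<bar>\<^sup>2"] that by simp
    also have "\<dots> < 1" using sum_R \<epsilon> \<epsilon>0 abs_square_less_1[of \<epsilon>] by simp
    finally show False by simp
  qed
  obtain Y where Y: "isometry N n Y" "mat_adjoint M * V = Y * ?D"
    by (rule isometric_factor[OF mult_carrier_mat[OF M' Vc] gram]) (use pos in auto)
  note Yc = isometryD(1)[OF Y(1)]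
  let ?\<Psi> = "Y * mat_adjoint V"
  have \<Psi>: "isometry N n ?\<Psi>" by (rule isometry_mult[OF Y(1) isometry_square_unitary(2)[OF V]])
  note \<Psi>c = isometryD(1)[OF \<Psi>]
  have "?\<Psi> * V = Y * (mat_adjoint V * V)" using Yc Vc by (simp add: assoc_mult_mat_dim)
  then have \<Psi>V: "?\<Psi> * V = Y" using isometryD(2)[OF V] Yc by simp
  let ?S = "mat_diag n (\<lambda>i. complex_of_real (\<sigma> i - 1))"
  have "(mat_adjoint M - ?\<Psi>) * V = Y * ?D - Y"
    unfolding minus_mult_distrib_mat[OF M' \<Psi>c Vc] \<Psi>V Y(2) ..
  also have "\<dots> = Y * ?S"
    unfolding mat_diag_mult_right[OF Yc] using Yc by (intro eq_matI) (auto simp: algebra_simps)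
  finally have "frob_norm ?S = frob_norm ((mat_adjoint M - ?\<Psi>) * V)"
    using frob_norm_isometry_left[OF Y(1) mat_diag_dim, of "\<lambda>i. complex_of_real (\<sigma> i - 1)"] by simp
  also have "\<dots> = frob_norm (mat_adjoint M - ?\<Psi>)"
    using frob_norm_isometry_right[OF isometry_square_unitary(2)[OF V]
        minus_carrier_mat[OF \<Psi>c], of "mat_adjoint M"]
    by simp
  also have "\<dots> = frob_norm (M - mat_adjoint ?\<Psi>)"
    using mat_adjoint_minus[OF M' \<Psi>c] by (metis frob_norm_adjoint mat_adjoint_adjoint)
  finally have "(frob_norm (M - mat_adjoint ?\<Psi>))\<^sup>2 = (\<Sum>i<n. \<bar>\<sigma> i - 1\<bar>\<^sup>2)"
    using frob_norm_diag[of n "\<lambda>i. complex_of_real (\<sigma> i - 1)"] by (simp del: of_real_diff)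
  also have "\<dots> \<le> (\<Sum>i<n. \<bar>(\<sigma> i)\<^sup>2 - 1\<bar>\<^sup>2)"
  proof (intro sum_mono power_mono)
    fix i assume "i \<in> {..<n}"
    then have "0 \<le> \<sigma> i" using nonneg by simp
    then have "\<bar>\<sigma> i - 1\<bar> * 1 \<le> \<bar>\<sigma> i - 1\<bar> * \<bar>\<sigma> i + 1\<bar>" by (intro mult_left_mono) auto
    then show "\<bar>\<sigma> i - 1\<bar> \<le> \<bar>(\<sigma> i)\<^sup>2 - 1\<bar>"
      by (simp add: abs_mult[symmetric] power2_eq_square algebra_simps)
  qed auto
  also note sum_R
  finally have "frob_norm (M - mat_adjoint ?\<Psi>) \<le> \<epsilon>" using \<epsilon>0 by (rule power2_le_imp_le)
  with \<Psi> show thesis by (rule that)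
qed

text \<open>If \<open>U U\<^sup>*\<close> is singular, the tolerance is zero and the two Gram matrices agree. Otherwise
  \<open>M = U\<^sup>-\<^sup>1 W\<close> satisfies \<open>M M\<^sup>* - I = U\<^sup>-\<^sup>1 (W W\<^sup>* - U U\<^sup>*) U\<^sup>-\<^sup>*\<close>, and since
  \<open>\<parallel>U\<^sup>-\<^sup>1\<parallel>\<^sup>2 = 1 / sigma_min (U U\<^sup>*)\<close>, the relative tolerance makes \<open>M\<close> close to a coisometry, no matter how badly
  conditioned \<open>U\<close> is.\<close>
lemma square_root_factor_perturbation:
  fixes U W :: "complex mat"
  assumes U: "U \<in> carrier_mat n n" and W: "W \<in> carrier_mat n N" and n: "1 \<le> n"
    and size: "n \<le> N \<or> invertible_mat (U * mat_adjoint U)" and \<epsilon>: "0 \<le> \<epsilon>" "\<epsilon> < 1"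
    and near: "frob_norm (U * mat_adjoint U - W * mat_adjoint W) \<le> \<epsilon> * sigma_min (U * mat_adjoint U)"
    and u: "op_bound U u"
  obtains \<Psi> where "isometry N n \<Psi>" "frob_norm (W - U * mat_adjoint \<Psi>) \<le> u * \<epsilon>"
proof -
  let ?P = "U * mat_adjoint U"
  define m where "m = sigma_min ?P"
  have U': "mat_adjoint U \<in> carrier_mat n n" and W': "mat_adjoint W \<in> carrier_mat N n"
    using U W by auto
  have P: "?P \<in> carrier_mat n n" using U by auto
  have WW: "W * mat_adjoint W \<in> carrier_mat n n" using W by auto
  note m = smallest_singular_value_gram[OF U n, folded m_def]
  show thesis
  proof (cases "m = 0")
    case True
    then have le: "n \<le> N" using m(3) size by blast
    have "frob_norm (?P - W * mat_adjoint W) = 0"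
      using near True frob_norm_nonneg[of "?P - W * mat_adjoint W"]
      by (intro antisym) (simp_all add: m_def)
    then have zero: "?P - W * mat_adjoint W = 0\<^sub>m n n"
      by (rule frob_norm_eq_0D) (rule minus_carrier_mat[OF WW])
    have "?P = W * mat_adjoint W"
    proof (rule eq_matI)
      fix i j assume "i < dim_row (W * mat_adjoint W)" "j < dim_col (W * mat_adjoint W)"
      then have "(?P - W * mat_adjoint W) $$ (i, j) = 0" "i < n" "j < n"
        unfolding zero using W by auto
      then show "?P $$ (i, j) = (W * mat_adjoint W) $$ (i, j)"
        using U W by (simp del: index_mult_mat(1))
    qed (use U W in auto)
    then obtain \<Psi> where \<Psi>: "isometry N n \<Psi>" "W = U * mat_adjoint \<Psi>"
      using same_gram_isometry[OF U W le] by blast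
    have "W - U * mat_adjoint \<Psi> = 0\<^sub>m n N" using W by (simp add: \<Psi>(2)[symmetric])
    then have "frob_norm (W - U * mat_adjoint \<Psi>) \<le> u * \<epsilon>"
      using op_bound_nonneg[OF u] \<epsilon> by (simp add: frob_norm_def)
    with \<Psi>(1) show thesis by (rule that)
  next
    case False
    then have mpos: "0 < m" using m(1) by simp
    \<comment> \<open>\<open>K'\<close> is the inverse of \<open>U\<^sup>*\<close>; the lower bound for \<open>\<parallel>U\<^sup>* v\<parallel>\<close> is an upper bound for \<open>K'\<close>.\<close>
    obtain K' where K': "K' \<in> carrier_mat n n" "K' * mat_adjoint U = 1\<^sub>m n" "mat_adjoint U * K' = 1\<^sub>m n"
    proof (rule injective_imp_inverse[OF U'])
      fix v assume v: "v \<in> carrier_vec n" "mat_adjoint U *\<^sub>v v = 0\<^sub>v n"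
      have "m * (l2_norm v)\<^sup>2 \<le> 0" using m(2)[OF v(1)] by (simp add: v(2))
      then have "l2_norm v = 0" using mpos by (simp add: mult_le_0_iff)
      then show "v = 0\<^sub>v n" using v(1) l2_norm_eq_0 by blast
    qed
    define K where "K = mat_adjoint K'"
    have K: "K \<in> carrier_mat n n" using K' by (simp add: K_def)
    have UK: "U * K = 1\<^sub>m n"
      using arg_cong[OF K'(2), of mat_adjoint] by (simp add: K_def mat_adjoint_mult[OF K'(1) U'])
    have KU: "K * U = 1\<^sub>m n"
      using arg_cong[OF K'(3), of mat_adjoint] by (simp add: K_def mat_adjoint_mult[OF U' K'(1)])
    have K'_bound: "op_bound K' (1 / sqrt m)"
      unfolding op_bound_def
    proof (intro conjI ballI)
      fix y :: "complex vec" assume "y \<in> carrier_vec (dim_col K')"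
      then have y: "y \<in> carrier_vec n" using K' by auto
      have K'y: "K' *\<^sub>v y \<in> carrier_vec n" using K' y by auto
      have "mat_adjoint U *\<^sub>v (K' *\<^sub>v y) = y"
        using K' y U' by (simp add: assoc_mult_mat_vec[symmetric, of _ n n _ n])
      then have "m * (l2_norm (K' *\<^sub>v y))\<^sup>2 \<le> (l2_norm y)\<^sup>2" using m(2)[OF K'y] by simp
      then have "sqrt (m * (l2_norm (K' *\<^sub>v y))\<^sup>2) \<le> sqrt ((l2_norm y)\<^sup>2)" by (rule real_sqrt_le_mono)
      then have "sqrt m * l2_norm (K' *\<^sub>v y) \<le> l2_norm y" by (simp add: real_sqrt_mult)
      then show "l2_norm (K' *\<^sub>v y) \<le> 1 / sqrt m * l2_norm y" using mpos by (simp add: field_simps)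
    qed (use mpos in simp)
    have K_bound: "op_bound K (1 / sqrt m)" unfolding K_def by (rule op_bound_adjoint[OF K'_bound])
    define M where "M = K * W"
    have M: "M \<in> carrier_mat n N" using K W by (auto simp: M_def)
    have "K * ?P * K' = 1\<^sub>m n"
    proof -
      have "K * ?P * K' = (K * U) * (mat_adjoint U * K')" using K U K'(1) by (simp add: assoc_mult_mat_dim)
      then show ?thesis by (simp add: KU K'(3))
    qed
    moreover have "M * mat_adjoint M = K * (W * mat_adjoint W) * K'"
      using K W K'(1) by (simp add: M_def mat_adjoint_mult[OF K W] assoc_mult_mat_dim) (simp add: K_def)
    ultimately have "M * mat_adjoint M - 1\<^sub>m n = K * (W * mat_adjoint W - ?P) * K'"
      using K WW P K'(1)
      by (simp add: mult_minus_distrib_mat[OF K WW P] minus_mult_distrib_mat[OF mult_carrier_mat[OF K WW] mult_carrier_mat[OF K P] K'(1)])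
    also have "frob_norm \<dots> \<le> frob_norm (K * (W * mat_adjoint W - ?P)) * (1 / sqrt m)"
      by (rule frob_norm_mult_right[OF K'_bound K'(1) mult_carrier_mat[OF K minus_carrier_mat[OF P]]])
    also have "\<dots> \<le> (1 / sqrt m * frob_norm (W * mat_adjoint W - ?P)) * (1 / sqrt m)"
      using mpos by (intro mult_right_mono frob_norm_mult_left[OF K_bound K minus_carrier_mat[OF P]]) simp
    also have "frob_norm (W * mat_adjoint W - ?P) = frob_norm (?P - W * mat_adjoint W)"
      by (rule frob_norm_minus_commute[OF WW P])
    also have "1 / sqrt m * frob_norm (?P - W * mat_adjoint W) * (1 / sqrt m)
        = frob_norm (?P - W * mat_adjoint W) / m"
      using mpos by (simp add: field_simps)
    also have "\<dots> \<le> \<epsilon>" using near mpos by (simp add: m_def[symmetric] pos_divide_le_eq)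
    finally obtain \<Psi> where \<Psi>: "isometry N n \<Psi>" "frob_norm (M - mat_adjoint \<Psi>) \<le> \<epsilon>"
      using near_coisometry[OF M \<epsilon>(2)] by blast
    note \<Psi>c = isometryD(1)[OF \<Psi>(1)]
    have "U * M = W" using U K W UK by (simp add: M_def assoc_mult_mat[OF U K W, symmetric])
    then have "W - U * mat_adjoint \<Psi> = U * (M - mat_adjoint \<Psi>)"
      using \<Psi>c by (subst mult_minus_distrib_mat[OF U M]) auto
    then have "frob_norm (W - U * mat_adjoint \<Psi>) \<le> u * frob_norm (M - mat_adjoint \<Psi>)"
      using frob_norm_mult_left[OF u U minus_carrier_mat, of "mat_adjoint \<Psi>" N M] \<Psi>c by simp
    also have "\<dots> \<le> u * \<epsilon>" using \<Psi>(2) op_bound_nonneg[OF u] by (rule mult_left_mono)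
    finally show thesis using \<Psi>(1) that by blast
  qed
qed

section \<open>Perturbation of the product of two factors\<close>

text \<open>The two factors are exchanged one after the other,
  \<open>X E W - Y E Z = (X - Y) E W + Y E (W - Z)\<close>, which leaves \<open>W\<close> in the first term; its norm is at most
  \<open>u + u \<epsilon>\<close>.\<close>
lemma product_perturbation:
  assumes X: "X \<in> carrier_mat p n" and Y: "Y \<in> carrier_mat p n" "op_bound Y l"
    and E: "E \<in> carrier_mat n n" "op_bound E e"
    and W: "W \<in> carrier_mat n q" and Z: "Z \<in> carrier_mat n q" "op_bound Z u"
    and XY: "frob_norm (X - Y) \<le> l * \<epsilon>" and WZ: "frob_norm (W - Z) \<le> u * \<epsilon>"
  shows "frob_norm (X * E * W - Y * E * Z) \<le> \<epsilon> * (2 + \<epsilon>) * (e * l * u)"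
proof -
  note nonneg = op_bound_nonneg[OF Y(2)] op_bound_nonneg[OF E(2)] op_bound_nonneg[OF Z(2)]
  have XmY: "X - Y \<in> carrier_mat p n" and WmZ: "W - Z \<in> carrier_mat n q"
    by (rule minus_carrier_mat[OF Y(1)], rule minus_carrier_mat[OF Z(1)])
  have u\<epsilon>: "0 \<le> u * \<epsilon>" using WZ frob_norm_nonneg order_trans by blast
  have "W = Z + (W - Z)" using W Z by (intro eq_matI) auto
  moreover have "op_bound (Z + (W - Z)) (u + u * \<epsilon>)"
  proof (rule op_bound_add[OF Z(2,1) _ WmZ])
    show "op_bound (W - Z) (u * \<epsilon>)"
      unfolding op_bound_def
    proof (intro conjI ballI u\<epsilon>)
      fix v :: "complex vec" assume "v \<in> carrier_vec (dim_col (W - Z))"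
      then have "l2_norm ((W - Z) *\<^sub>v v) \<le> frob_norm (W - Z) * l2_norm v"
        using op_bound_frob_norm[of "W - Z"] by (simp add: op_bound_def)
      also have "\<dots> \<le> u * \<epsilon> * l2_norm v" using WZ by (intro mult_right_mono) auto
      finally show "l2_norm ((W - Z) *\<^sub>v v) \<le> u * \<epsilon> * l2_norm v" .
    qed
  qed
  ultimately have W_bound: "op_bound W (u + u * \<epsilon>)" by simp
  have EW: "E * W \<in> carrier_mat n q" and EZ: "E * Z \<in> carrier_mat n q" using E W Z by auto
  have "X * E * W - Y * E * Z = X * (E * W) - Y * (E * Z)"
    using X Y E W Z by (simp add: assoc_mult_mat_dim)
  also have "\<dots> = (X * (E * W) - Y * (E * W)) + (Y * (E * W) - Y * (E * Z))"
    using X Y E W Z by (intro eq_matI) (auto simp del: index_mult_mat(1))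
  also have "\<dots> = (X - Y) * (E * W) + Y * (E * (W - Z))"
    unfolding minus_mult_distrib_mat[OF X Y(1) EW] mult_minus_distrib_mat[OF E(1) W Z(1)]
      mult_minus_distrib_mat[OF Y(1) EW EZ] ..
  finally have "frob_norm (X * E * W - Y * E * Z)
      \<le> frob_norm ((X - Y) * (E * W)) + frob_norm (Y * (E * (W - Z)))"
    using frob_norm_triangle[OF mult_carrier_mat[OF XmY EW] mult_carrier_mat[OF Y(1) mult_carrier_mat[OF E(1) WmZ]]]
    by simp
  also have "\<dots> \<le> (l * \<epsilon>) * (e * (u + u * \<epsilon>)) + l * (e * (u * \<epsilon>))"
  proof (rule add_mono)
    have "frob_norm ((X - Y) * (E * W)) \<le> frob_norm (X - Y) * (e * (u + u * \<epsilon>))"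
      by (rule frob_norm_mult_right[OF op_bound_mult[OF E(2,1) W_bound W] EW XmY])
    also have "\<dots> \<le> (l * \<epsilon>) * (e * (u + u * \<epsilon>))"
      using XY nonneg u\<epsilon> by (intro mult_right_mono) auto
    finally show "frob_norm ((X - Y) * (E * W)) \<le> (l * \<epsilon>) * (e * (u + u * \<epsilon>))" .
    have "frob_norm (Y * (E * (W - Z))) \<le> l * frob_norm (E * (W - Z))"
      by (rule frob_norm_mult_left[OF Y(2,1) mult_carrier_mat[OF E(1) WmZ]])
    also have "\<dots> \<le> l * (e * frob_norm (W - Z))"
      using nonneg by (intro mult_left_mono frob_norm_mult_left[OF E(2,1) WmZ])
    also have "\<dots> \<le> l * (e * (u * \<epsilon>))"
      using nonneg WZ by (intro mult_left_mono)
    finally show "frob_norm (Y * (E * (W - Z))) \<le> l * (e * (u * \<epsilon>))" .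
  qed
  also have "\<dots> = \<epsilon> * (2 + \<epsilon>) * (e * l * u)" by (simp add: algebra_simps)
  finally show ?thesis .
qed

theorem proposition3p2:
  fixes n lp lq :: nat
    and E A U L :: "real mat" and b c :: "real vec"
    and \<zeta> \<rho> \<omega> \<phi> :: "nat \<Rightarrow> real" and \<rho>inf \<phi>inf :: "real option"
    and \<delta> :: real
  defines "P \<equiv> gramian_P n E A b"
    and "Q \<equiv> gramian_Q n E A c"
    and "Ut \<equiv> U_quad n E A b lp \<zeta> \<rho> \<rho>inf"
    and "Lts \<equiv> L_quad_star n E A c lq \<omega> \<phi> \<phi>inf"
    and "Pt \<equiv> P_quad n E A b lp \<zeta> \<rho> \<rho>inf"
    and "Qt \<equiv> Q_quad n E A c lq \<omega> \<phi> \<phi>inf"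
    and "Np \<equiv> num_nodes lp \<rho>inf"
    and "Nq \<equiv> num_nodes lq \<phi>inf"
    and "H \<equiv> cmat (transpose_mat L * E * U)"
    and "bound \<equiv> 2 * \<delta> * spectral_norm (cmat E) * spectral_norm (cmat L) * spectral_norm (cmat U)"
  assumes n: "1 \<le> n"
    and E: "E \<in> carrier_mat n n" and A: "A \<in> carrier_mat n n"
    and b: "b \<in> carrier_vec n" and c: "c \<in> carrier_vec n"
    and E_nonsingular: "invertible_mat E"
    and stable: "asymptotically_stable E A"
    and U: "U \<in> carrier_mat n n" and P_factor: "P = cmat (U * transpose_mat U)"
    and L: "L \<in> carrier_mat n n" and Q_factor: "Q = cmat (L * transpose_mat L)"
    and Np: "n \<le> Np \<or> invertible_mat P"
    and Nq: "n \<le> Nq \<or> invertible_mat Q"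
    and \<delta>: "0 < \<delta>" "\<delta> < 1"
    and Q_approx: "frob_norm (Q - Qt) \<le> \<delta> / (1 + \<delta>) * sigma_min Q"
    and P_approx: "frob_norm (P - Pt) \<le> \<delta> / (1 + \<delta>) * sigma_min P"
  shows "(\<exists>\<Psi>p \<Psi>q. isometry Np n \<Psi>p \<and> isometry Nq n \<Psi>q \<and>
           frob_norm (Lts * cmat E * Ut - \<Psi>q * H * mat_adjoint \<Psi>p) \<le> bound)
       \<and> sqrt (\<Sum>k=1..n. (sing_val H k - sing_val (Lts * cmat E * Ut) k)\<^sup>2) \<le> bound"
proof -
  define \<epsilon> where "\<epsilon> = \<delta> / (1 + \<delta>)"
  have \<epsilon>: "0 \<le> \<epsilon>" "\<epsilon> < 1" "\<epsilon> * (2 + \<epsilon>) \<le> 2 * \<delta>"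
  proof -
    show "0 \<le> \<epsilon>" "\<epsilon> < 1" using \<delta> by (simp_all add: \<epsilon>_def field_simps)
    \<comment> \<open>The definition of \<open>\<epsilon>\<close> says \<open>\<epsilon> (1 + \<delta>) = \<delta>\<close>, and \<open>2 + \<epsilon> \<le> 2 (1 + \<delta>)\<close>.\<close>
    have "\<epsilon> \<le> \<delta>" using \<delta> by (simp add: \<epsilon>_def field_simps)
    then have "\<epsilon> * (2 + \<epsilon>) \<le> \<epsilon> * (2 + 2 * \<delta>)" using \<delta> \<open>0 \<le> \<epsilon>\<close> by (intro mult_left_mono) auto
    also have "\<dots> = 2 * \<delta>" using \<delta> by (simp add: \<epsilon>_def field_simps)
    finally show "\<epsilon> * (2 + \<epsilon>) \<le> 2 * \<delta>" .
  qed
  let ?U = "cmat U" and ?L = "cmat L" and ?E = "cmat E"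
  have cU: "?U \<in> carrier_mat n n" and cL: "?L \<in> carrier_mat n n" and cE: "?E \<in> carrier_mat n n"
    using U L E by auto
  have Ut: "Ut \<in> carrier_mat n Np" unfolding Ut_def Np_def by (rule U_quad_carrier)
  have Lts: "Lts \<in> carrier_mat Nq n" unfolding Lts_def Nq_def by (rule L_quad_star_carrier)
  have P: "P = ?U * mat_adjoint ?U"
    unfolding P_factor mat_adjoint_cmat using U by (intro cmat_mult) auto
  have Q: "Q = ?L * mat_adjoint ?L"
    unfolding Q_factor mat_adjoint_cmat using L by (intro cmat_mult) auto
  have Pt: "Pt = Ut * mat_adjoint Ut" by (simp add: Pt_def Ut_def P_quad_def)
  have Qt: "Qt = mat_adjoint Lts * mat_adjoint (mat_adjoint Lts)" by (simp add: Qt_def Lts_def Q_quad_def)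
  have bU: "op_bound ?U (spectral_norm ?U)" and bL: "op_bound ?L (spectral_norm ?L)"
    and bE: "op_bound ?E (spectral_norm ?E)"
    using n U L E by (auto intro!: op_bound_spectral_norm)
  obtain \<Psi>p where \<Psi>p: "isometry Np n \<Psi>p" "frob_norm (Ut - ?U * mat_adjoint \<Psi>p) \<le> spectral_norm ?U * \<epsilon>"
    by (rule square_root_factor_perturbation[OF cU Ut n Np[unfolded P] \<epsilon>(1,2)
          P_approx[unfolded P Pt, folded \<epsilon>_def] bU])
  have Lt: "mat_adjoint Lts \<in> carrier_mat n Nq" using Lts by simp
  obtain \<Psi>q where \<Psi>q: "isometry Nq n \<Psi>q"
    "frob_norm (mat_adjoint Lts - ?L * mat_adjoint \<Psi>q) \<le> spectral_norm ?L * \<epsilon>"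
    by (rule square_root_factor_perturbation[OF cL Lt n Nq[unfolded Q] \<epsilon>(1,2)
          Q_approx[unfolded Q Qt, folded \<epsilon>_def] bL])
  note \<Psi>pc = isometryD(1)[OF \<Psi>p(1)] and \<Psi>qc = isometryD(1)[OF \<Psi>q(1)]
  let ?Y = "\<Psi>q * mat_adjoint ?L" and ?Z = "?U * mat_adjoint \<Psi>p"
  have Y: "?Y \<in> carrier_mat Nq n" and Z: "?Z \<in> carrier_mat n Np" using \<Psi>qc \<Psi>pc cL cU by auto
  have "op_bound ?Y (1 * spectral_norm ?L)"
    by (rule op_bound_mult[OF isometry_op_bound[OF \<Psi>q(1)] \<Psi>qc op_bound_adjoint[OF bL]]) (use cL in auto)
  moreover have "op_bound ?Z (spectral_norm ?U * 1)"
    by (rule op_bound_mult[OF bU cU op_bound_adjoint[OF isometry_op_bound[OF \<Psi>p(1)]]]) (use \<Psi>pc in auto)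
  moreover have "frob_norm (Lts - ?Y) \<le> spectral_norm ?L * \<epsilon>"
  proof -
    have "mat_adjoint (Lts - ?Y) = mat_adjoint Lts - ?L * mat_adjoint \<Psi>q"
      using \<Psi>qc cL by (simp add: mat_adjoint_minus[OF Lts Y] mat_adjoint_mult[of _ Nq n _ n])
    then show ?thesis using \<Psi>q(2) by (metis frob_norm_adjoint)
  qed
  ultimately have "frob_norm (Lts * ?E * Ut - ?Y * ?E * ?Z)
      \<le> \<epsilon> * (2 + \<epsilon>) * (spectral_norm ?E * spectral_norm ?L * spectral_norm ?U)"
    using product_perturbation[OF Lts Y _ cE bE Ut Z _ _ \<Psi>p(2)] by simp
  also have "\<dots> \<le> 2 * \<delta> * (spectral_norm ?E * spectral_norm ?L * spectral_norm ?U)"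
    using \<epsilon>(3) op_bound_nonneg[OF bE] op_bound_nonneg[OF bL] op_bound_nonneg[OF bU]
    by (intro mult_right_mono) auto
  also have "\<dots> = bound" by (simp add: bound_def)
  also have "?Y * ?E * ?Z = \<Psi>q * H * mat_adjoint \<Psi>p"
  proof -
    have "H = mat_adjoint ?L * ?E * ?U"
      unfolding H_def mat_adjoint_cmat using L E U by (simp add: cmat_mult[of _ n n _ n])
    then show ?thesis using \<Psi>qc \<Psi>pc cL cE cU by (simp add: assoc_mult_mat_dim)
  qed
  finally have main: "frob_norm (Lts * ?E * Ut - \<Psi>q * H * mat_adjoint \<Psi>p) \<le> bound" .
  moreover have "sqrt (\<Sum>k=1..n. (sing_val H k - sing_val (Lts * ?E * Ut) k)\<^sup>2)
      \<le> frob_norm (Lts * ?E * Ut - \<Psi>q * H * mat_adjoint \<Psi>p)"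
  proof (rule Mirsky_isometries[OF _ _ \<Psi>q(1) \<Psi>p(1)])
    show "H \<in> carrier_mat n n" using L E U by (auto simp: H_def)
    show "Lts * ?E * Ut \<in> carrier_mat Nq Np" using Lts cE Ut by auto
    show "n \<le> Nq" "n \<le> Np" using isometry_imp_le \<Psi>q(1) \<Psi>p(1) by blast+
  qed
  ultimately show ?thesis using \<Psi>p(1) \<Psi>q(1) by (meson order_trans)
qed

end
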